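(* Let $\varphi$ be a nonnegative Borel function on $\mathbb{D}$, and let $$\varphi^H(\zeta):=\sup_{z\in\mathbb{D}}\varphi(z)\,\chi_{I_z}^*(\zeta),\qquad \zeta\in\partial\mathbb{D}.$$ (a) If $\varphi$ admits a positive harmonic majorant, then $\varphi^H\in L^1_w(\partial\mathbb{D})$. (b) If $\varphi$ admits a quasi-bounded positive harmonic majorant, then $\varphi^H\in L^1_{w,0}(\partial\mathbb{D})$.
   Context: $\mathbb{D}$ is the open unit disc, $\sigma$ is normalized Lebesgue measure on $\partial\mathbb{D}$. Fix an aperture $\alpha\ge1$; the Stolz angle with vertex $\zeta\in\partial\mathbb{D}$ is $\Gamma(\zeta)=\{z\in\mathbb{D}:|z-\zeta|\le\alpha(1-|z|^2)\}$, and the Privalov shadow of $z\in\mathbb{D}$ is the arc $I_z=\{\zeta\in\partial\mathbb{D}:z\in\Gamma(\zeta)\}$, with characteristic function $\chi_{I_z}$. For a nonnegative function $f$ on $\partial\mathbb{D}$, its Hardy–Littlewood maximal function is $f^*(x)=\sup_{I\ni x}\frac1{\sigma(I)}\int_I f\,d\sigma$, the supremum over arcs $I\subset\partial\mathbb{D}$ containing $x$. $L^1_w(\partial\mathbb{D})$ is the set of measurable $f$ with $\sup_{t>0}t\,\sigma\{\zeta:|f(\zeta)|>t\}<\infty$; $L^1_{w,0}(\partial\mathbb{D})$ is the set of measurable $f$ with $\lim_{t\to\infty}t\,\sigma\{\zeta:|f(\zeta)|>t\}=0$. A positive harmonic majorant of $\varphi$ is a harmonic function $h\ge0$ on $\mathbb{D}$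 with $h\ge\varphi$ on $\mathbb{D}$. A positive harmonic function is quasi-bounded if it is the Poisson integral $\int_{\partial\mathbb{D}}\frac{1-|z|^2}{|\zeta-z|^2}\,d\mu(\zeta)$ of a measure $\mu$ absolutely continuous with respect to $\sigma$. *)

theory Defs
  imports "HOL-Analysis.Analysis"
begin

abbreviation unit_disc :: "complex set" where
  "unit_disc \<equiv> ball 0 1"

abbreviation unit_circle :: "complex set" where
  "unit_circle \<equiv> sphere 0 1"

(* The Borel version of normalized Lebesgue measure on the circle; Lebesgue measurability
   is expressed below with its completion. *)
definition circle_measure :: "complex measure" where
  "circle_measure =
     distr (uniform_measure lborel {0..<2 * pi}) (restrict_space borel unit_circle) cis"

definition stolz_angle :: "real \<Rightarrow> complex \<Rightarrow> complex set" where
  "stolz_angle \<alpha> \<zeta> = {z \<in> unit_disc. cmod (z - \<zeta>) \<le> \<alpha> * (1 - (cmod z)\<^sup>2)}"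

definition privalov_shadow :: "real \<Rightarrow> complex \<Rightarrow> complex set" where
  "privalov_shadow \<alpha> z = {\<zeta> \<in> unit_circle. z \<in> stolz_angle \<alpha> \<zeta>}"

(* Nondegenerate arcs: each endpoint may or may not belong to the arc, and the whole circle
   (b = a + 2 * pi) is allowed. *)
definition circle_arcs :: "complex set set" where
  "circle_arcs =
     {cis ` J | J a b. a < b \<and> b \<le> a + 2 * pi \<and> {a<..<b} \<subseteq> J \<and> J \<subseteq> {a..b}}"

definition hl_maximal :: "(complex \<Rightarrow> ennreal) \<Rightarrow> complex \<Rightarrow> ennreal" where
  "hl_maximal f x =
     (SUP I\<in>{I \<in> circle_arcs. x \<in> I}.
        (\<integral>\<^sup>+\<zeta>\<in>I. f \<zeta> \<partial>circle_measure) / emeasure circle_measure I)"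

(* The function written \<phi>\<^sup>H in the source; it may take the value infinity. *)
definition shadow_maximal :: "real \<Rightarrow> (complex \<Rightarrow> real) \<Rightarrow> complex \<Rightarrow> ennreal" where
  "shadow_maximal \<alpha> \<phi> \<zeta> =
     (SUP z\<in>unit_disc. ennreal (\<phi> z) * hl_maximal (indicator (privalov_shadow \<alpha> z)) \<zeta>)"

definition circle_tail :: "(complex \<Rightarrow> ereal) \<Rightarrow> real \<Rightarrow> ennreal" where
  "circle_tail f t =
     emeasure (completion circle_measure) {\<zeta> \<in> unit_circle. \<bar>f \<zeta>\<bar> > ereal t}"

(* Functions are extended-real valued; membership in either space forces them to be finite
   almost everywhere. Their values off the circle are irrelevant. *)
definition weak_L1 :: "(complex \<Rightarrow> ereal) set" where
  "weak_L1 = {f \<in> borel_measurable (completion circle_measure).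
     (SUP t\<in>{0<..}. ennreal t * circle_tail f t) < \<infinity>}"

definition weak_L1_0 :: "(complex \<Rightarrow> ereal) set" where
  "weak_L1_0 = {f \<in> borel_measurable (completion circle_measure).
     ((\<lambda>t. ennreal t * circle_tail f t) \<longlongrightarrow> 0) at_top}"

(* Twice continuously differentiable with vanishing Laplacian: hx, hy are the first and
   hxx, hxy, hyx, hyy the second partial derivatives of h. *)
definition harmonic_on :: "(complex \<Rightarrow> real) \<Rightarrow> complex set \<Rightarrow> bool" where
  "harmonic_on h S \<longleftrightarrow>
     (\<exists>hx hy hxx hxy hyx hyy.
        (\<forall>z\<in>S.
           (h has_derivative (\<lambda>w. hx z * Re w + hy z * Im w)) (at z) \<and>
           (hx has_derivative (\<lambda>w. hxx z * Re w + hxy z * Im w)) (at z) \<and>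
           (hy has_derivative (\<lambda>w. hyx z * Re w + hyy z * Im w)) (at z) \<and>
           hxx z + hyy z = 0) \<and>
        continuous_on S hxx \<and> continuous_on S hxy \<and>
        continuous_on S hyx \<and> continuous_on S hyy)"

definition positive_harmonic :: "(complex \<Rightarrow> real) \<Rightarrow> bool" where
  "positive_harmonic h \<longleftrightarrow> harmonic_on h unit_disc \<and> (\<forall>z\<in>unit_disc. 0 \<le> h z)"

definition positive_harmonic_majorant :: "(complex \<Rightarrow> real) \<Rightarrow> (complex \<Rightarrow> real) \<Rightarrow> bool" where
  "positive_harmonic_majorant h \<phi> \<longleftrightarrow>
     positive_harmonic h \<and> (\<forall>z\<in>unit_disc. \<phi> z \<le> h z)"

definition poisson_integral :: "complex measure \<Rightarrow> complex \<Rightarrow> real" where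
  "poisson_integral \<mu> z = (\<integral>\<zeta>. (1 - (cmod z)\<^sup>2) / (cmod (\<zeta> - z))\<^sup>2 \<partial>\<mu>)"

definition quasi_bounded :: "(complex \<Rightarrow> real) \<Rightarrow> bool" where
  "quasi_bounded h \<longleftrightarrow>
     positive_harmonic h \<and>
     (\<exists>\<mu>. finite_measure \<mu> \<and> sets \<mu> = sets circle_measure \<and>
          absolutely_continuous circle_measure \<mu> \<and>
          (\<forall>z\<in>unit_disc. h z = poisson_integral \<mu> z))"

end

(*
  The maximal function of a shadow satisfies M(z, zeta) <= C (1 - |z|) / |zeta - z|. Multiplied by this
  factor, the Poisson kernel of z is dominated by a sum of dyadic multiples of indicators of balls
  about zeta, so if phi is at most the Poisson integral of mu, then phi^H > t at zeta forces
  mu(B(zeta, r)) >= c t r for some r, and Vitali's covering lemma bounds the measure of such points by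
  C mu(circle) / t.

  For (a), Herglotz' theorem is avoided: the estimate is applied to the dilations z |-> h(r z), which
  are Poisson integrals of their boundary values with total mass h(0), and passes to the limit r -> 1.
  For (b), write mu = f sigma. The part of f below N adds at most 2 N r to the mass of a ball of radius
  r, which is negligible for large t, and the part above N has small total mass.
*)
theory Submission
  imports Defs "HOL-Complex_Analysis.Complex_Analysis"
begin

section \<open>Arcs and balls on the circle\<close>

text \<open>When z approaches the circle tangentially as seen from \<zeta>, the Poisson kernel of z
  peaks near 2 / (1 - |z|), on a set too small to be compared with a ball about \<zeta>. The factor
  (1 - |z|) / |\<zeta> - z| lowers this peak to 2 / |\<zeta> - z|, which matches the ball of radius
  |\<zeta> - z| about \<zeta>. The quadratic decay of the kernel then leaves a geometric series over
  the larger balls.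

  The suprema range over uncountably many arcs and uncountably many z. Measurability therefore comes
  from topology: superlevel sets are unions of relatively open sets.

  The constants multiply as follows. The maximal function of a shadow costs 66 \<alpha> and the
  dyadic series 32, together 2112 \<alpha>. The covering costs 10 = 2 * 5, from the bound 2 r for
  the measure of a ball and the factor 5 of Vitali. This gives 21120 \<alpha> in (a), and twice as
  much in (b), where half of the density is conceded to the bounded part of f.\<close>

lemma sets_circle_measure [measurable_cong]:
  "sets circle_measure = sets (restrict_space borel unit_circle)"
  by (simp add: circle_measure_def)

lemma space_circle_measure: "space circle_measure = unit_circle"
  by (simp add: circle_measure_def space_restrict_space)

lemma measurable_cis_circle:
  "cis \<in> measurable (uniform_measure lborel {0..<2 * pi}) (restrict_space borel unit_circle)"
proof -
  have "cis \<in> borel_measurable lborel"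
    by (simp add: borel_measurable_continuous_onI continuous_intros)
  then have "cis \<in> borel_measurable (uniform_measure lborel {0..<2 * pi})"
    by (simp add: measurable_def)
  then show ?thesis
    by (intro measurable_restrict_space2) auto
qed

lemma borel_circle_iff: "B \<in> sets circle_measure \<longleftrightarrow> B \<in> sets borel \<and> B \<subseteq> unit_circle"
  by (auto simp: sets_circle_measure sets_restrict_space_iff)

lemma measurable_cis [measurable]: "cis \<in> borel_measurable borel"
  by (simp add: borel_measurable_continuous_onI continuous_intros)

lemma emeasure_circle_measure:
  assumes "B \<in> sets circle_measure"
  shows "emeasure circle_measure B =
    emeasure lborel {s \<in> {0..<2 * pi}. cis s \<in> B} / ennreal (2 * pi)"
proof -
  have B: "B \<in> sets borel" "B \<in> sets (restrict_space borel unit_circle)"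
    using assms by (simp_all add: borel_circle_iff flip: sets_circle_measure)
  have "{s. cis s \<in> B} \<in> sets borel"
    using measurable_sets[OF measurable_cis B(1)] by (simp add: vimage_def)
  then show ?thesis
    unfolding circle_measure_def
    by (subst emeasure_distr[OF measurable_cis_circle B(2)])
       (auto simp: vimage_def emeasure_uniform_measure Int_def intro!: arg_cong2[where f="(/)"] arg_cong[where f="emeasure lborel"])
qed

lemma nn_integral_circle_measure:
  assumes f: "f \<in> borel_measurable circle_measure"
  shows "(\<integral>\<^sup>+\<zeta>. f \<zeta> \<partial>circle_measure) =
    (\<integral>\<^sup>+s. f (cis s) * indicator {0..<2 * pi} s \<partial>lborel) / ennreal (2 * pi)"
proof -
  have f': "f \<in> borel_measurable (restrict_space borel unit_circle)"
    using f by (simp cong: measurable_cong_sets add: sets_circle_measure)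
  have "(\<lambda>s. f (cis s)) \<in> borel_measurable (uniform_measure lborel {0..<2 * pi})"
    using measurable_comp[OF measurable_cis_circle f'] by (simp add: comp_def)
  then have m: "(\<lambda>s. f (cis s)) \<in> borel_measurable lborel"
    by (simp add: measurable_def)
  show ?thesis
    unfolding circle_measure_def
    by (subst nn_integral_distr[OF measurable_cis_circle]) (use f' m in \<open>auto simp: nn_integral_uniform_measure\<close>)
qed

lemma emeasure_circle_measure_UNIV: "emeasure circle_measure unit_circle = 1"
proof -
  have "{s \<in> {0..<2 * pi}. cis s \<in> unit_circle} = {0..<2 * pi}" by auto
  then show ?thesis
    by (subst emeasure_circle_measure) (auto simp: borel_circle_iff divide_ennreal)
qed

lemma finite_measure_circle_measure: "finite_measure circle_measure"
  by (rule finite_measureI) (simp add: space_circle_measure emeasure_circle_measure_UNIV)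

section \<open>Comparison of chords and angles\<close>

lemma cmod_cis_diff: "cmod (cis a - cis b) = 2 * \<bar>sin ((a - b) / 2)\<bar>"
proof -
  have *: "2 * ((a - b) / 2) = a - b" by simp
  have "(cmod (cis a - cis b))\<^sup>2 = (cos a - cos b)\<^sup>2 + (sin a - sin b)\<^sup>2"
    by (simp add: cmod_power2)
  also have "\<dots> = 2 - 2 * cos (a - b)"
    using sin_cos_squared_add[of a] sin_cos_squared_add[of b]
    by (simp add: cos_diff power2_diff algebra_simps)
  also have "\<dots> = 2 - 2 * cos (2 * ((a - b) / 2))" by (simp only: *)
  also have "\<dots> = (2 * \<bar>sin ((a - b) / 2)\<bar>)\<^sup>2"
    unfolding cos_double_sin by (simp add: power_mult_distrib)
  finally show ?thesis
    by (rule power2_eq_imp_eq) auto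
qed

lemma cmod_cis_diff_le: "cmod (cis a - cis b) \<le> \<bar>a - b\<bar>"
  unfolding cmod_cis_diff using abs_sin_x_le_abs_x[of "(a - b) / 2"] by simp

text \<open>Sine is concave on [0, pi / 2] and so lies above the chord from (0, 0) to (pi / 2,
  1).\<close>

lemma jordan_sin_ge:
  assumes "0 \<le> x" "x \<le> pi / 2"
  shows "2 / pi * x \<le> sin x"
proof -
  have conc: "concave_on {0..pi/2} sin"
    by (rule f''_le0_imp_concave[where f' = cos and f'' = "\<lambda>x. - sin x"])
       (auto intro!: derivative_eq_intros sin_ge_zero)
  have "(1 - 2 * x / pi) * sin 0 + 2 * x / pi * sin (pi / 2)
      \<le> sin ((1 - 2 * x / pi) *\<^sub>R 0 + (2 * x / pi) *\<^sub>R (pi / 2))"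
    by (rule concave_onD[OF conc]) (use assms in \<open>auto simp: field_simps\<close>)
  then show ?thesis by simp
qed

text \<open>Half the angle lies in [0, pi / 2], where Jordan's inequality bounds the ratio of angle
  to chord by pi / 2. It is rounded up to 2 by means of pi < 4.\<close>

lemma abs_diff_le_cmod_cis_diff:
  assumes "\<bar>a - b\<bar> \<le> pi"
  shows "\<bar>a - b\<bar> \<le> 2 * cmod (cis a - cis b)"
proof -
  have *: "x \<le> 2 * sin x" if "0 \<le> x" "x \<le> pi / 2" for x :: real
  proof -
    have "x * pi \<le> x * 4" using that pi_less_4 by (intro mult_left_mono) auto
    then have "x \<le> 2 * (2 / pi * x)" by (simp add: field_simps)
    also have "\<dots> \<le> 2 * sin x" using jordan_sin_ge[OF that] by simp
    finally show ?thesis .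
  qed
  have "\<bar>a - b\<bar> / 2 \<le> 2 * \<bar>sin (\<bar>a - b\<bar> / 2)\<bar>"
  proof -
    have "\<bar>a - b\<bar> / 2 \<le> 2 * sin (\<bar>a - b\<bar> / 2)" using assms by (intro *) auto
    then show ?thesis by linarith
  qed
  also have "\<bar>sin (\<bar>a - b\<bar> / 2)\<bar> = \<bar>sin ((a - b) / 2)\<bar>"
    using sin_minus[of "(a - b) / 2"] by (cases "a \<ge> b") (simp_all add: abs_if minus_divide_left)
  finally show ?thesis unfolding cmod_cis_diff by simp
qed

lemma unit_circle_cisE:
  assumes "\<zeta> \<in> unit_circle"
  obtains s where "0 \<le> s" "s < 2 * pi" "\<zeta> = cis s"
proof
  have "\<zeta> \<noteq> 0" using assms by auto
  show "0 \<le> Arg2pi \<zeta>" "Arg2pi \<zeta> < 2 * pi"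
    using Arg2pi_ge_0 Arg2pi_lt_2pi by auto
  show "\<zeta> = cis (Arg2pi \<zeta>)"
    using Arg2pi_eq[of \<zeta>] assms by (simp add: cis_conv_exp)
qed

text \<open>\<open>Arg\<close> of the quotient \<zeta> / cis \<theta> lies in (-pi, pi]. Adding it
  to \<theta> picks the angle of \<zeta> nearest to \<theta>, so no multiple of 2 pi disturbs the
  comparison with the chord.\<close>

lemma unit_circle_near_cisE:
  assumes "\<zeta> \<in> unit_circle"
  obtains s where "\<zeta> = cis s" "\<bar>s - \<theta>\<bar> \<le> 2 * cmod (\<zeta> - cis \<theta>)"
proof -
  define w where "w = \<zeta> / cis \<theta>"
  have w: "w \<noteq> 0" "cmod w = 1" using assms by (auto simp: w_def norm_divide)
  have 1: "\<zeta> = cis (\<theta> + Arg w)"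
    using w by (simp add: cis_Arg sgn_div_norm flip: cis_mult) (simp add: w_def)
  have "\<bar>(\<theta> + Arg w) - \<theta>\<bar> \<le> 2 * cmod (cis (\<theta> + Arg w) - cis \<theta>)"
    by (rule abs_diff_le_cmod_cis_diff) (use Arg_bounded[of w] in auto)
  with 1 that show ?thesis by metis
qed

text \<open>Points near cis \<theta> have angles near \<theta>, with an error of at most twice the
  chord; hence the radius \<open>e / 2\<close>.\<close>

lemma openin_cis_image:
  assumes "open U"
  shows "openin (top_of_set unit_circle) (cis ` U)"
  unfolding openin_euclidean_subtopology_iff
proof (intro conjI ballI)
  fix x assume "x \<in> cis ` U"
  then obtain \<theta> where \<theta>: "\<theta> \<in> U" "x = cis \<theta>" by auto
  obtain e where e: "e > 0" "ball \<theta> e \<subseteq> U"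
    using assms \<theta> openE by blast
  have "y \<in> cis ` U" if y: "y \<in> unit_circle" "dist y x < e / 2" for y
  proof -
    obtain s where "y = cis s" "\<bar>s - \<theta>\<bar> \<le> 2 * cmod (y - cis \<theta>)"
      using unit_circle_near_cisE[OF y(1)] by blast
    moreover from this have "\<bar>s - \<theta>\<bar> < e" using y(2) \<theta> by (simp add: dist_norm)
    ultimately show ?thesis using e by (auto simp: dist_real_def abs_minus_commute intro!: imageI)
  qed
  with e show "\<exists>e>0. \<forall>x'\<in>unit_circle. dist x' x < e \<longrightarrow> x' \<in> cis ` U"
    by (metis half_gt_zero)
qed auto

lemma openin_circle_sets:
  assumes "openin (top_of_set unit_circle) S"
  shows "S \<in> sets circle_measure"
proof -
  obtain T where "open T" "S = unit_circle \<inter> T" using assms by (auto simp: openin_open)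
  then show ?thesis by (auto simp: borel_circle_iff)
qed

text \<open>Points at distance at most r have angles within 2 r of t modulo 2 pi. Both angles lie in
  [0, 2 pi), so the shifts by 0 and by plus or minus 2 pi suffice. The three intervals have total
  length 12 r, and 12 r / (2 pi) \<le> 2 r because pi > 3.\<close>

lemma emeasure_circle_cball_le:
  assumes \<zeta>: "\<zeta> \<in> unit_circle" and r: "0 \<le> r"
  shows "emeasure circle_measure (unit_circle \<inter> cball \<zeta> r) \<le> ennreal (2 * r)"
proof -
  obtain t where t: "0 \<le> t" "t < 2 * pi" "\<zeta> = cis t" using unit_circle_cisE[OF \<zeta>] .
  let ?J = "\<lambda>k. {t + 2 * pi * k - 2 * r .. t + 2 * pi * k + 2 * r}"
  have sub: "{s \<in> {0..<2 * pi}. cis s \<in> unit_circle \<inter> cball \<zeta> r} \<subseteq> ?J 0 \<union> (?J 1 \<union> ?J (-1))"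
  proof
    fix s assume "s \<in> {s \<in> {0..<2 * pi}. cis s \<in> unit_circle \<inter> cball \<zeta> r}"
    then have s: "0 \<le> s" "s < 2 * pi" "cmod (cis s - cis t) \<le> r"
      using t by (auto simp: dist_norm norm_minus_commute)
    have *: "s \<in> ?J k" if "\<bar>s - (t + 2 * pi * k)\<bar> \<le> pi" "cis (t + 2 * pi * k) = cis t" for k
      using abs_diff_le_cmod_cis_diff[OF that(1)] s(3) unfolding that(2) by (auto simp: abs_if split: if_splits)
    have "\<bar>s - t\<bar> \<le> pi \<or> \<bar>s - (t + 2 * pi)\<bar> \<le> pi \<or> \<bar>s - (t - 2 * pi)\<bar> \<le> pi"
      using s t by linarith
    then show "s \<in> ?J 0 \<union> (?J 1 \<union> ?J (-1))"
      using *[of 0] *[of 1] *[of "-1"]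
      by (auto simp: cis_mult[symmetric] cis_divide[symmetric] cis_inverse[symmetric])
  qed
  have "emeasure lborel {s \<in> {0..<2 * pi}. cis s \<in> unit_circle \<inter> cball \<zeta> r}
      \<le> emeasure lborel (?J 0 \<union> (?J 1 \<union> ?J (-1)))"
    by (rule emeasure_mono[OF sub]) auto
  also have "\<dots> \<le> emeasure lborel (?J 0) + (emeasure lborel (?J 1) + emeasure lborel (?J (-1)))"
    by (rule order_trans[OF emeasure_subadditive]) (auto intro!: add_left_mono emeasure_subadditive)
  also have "\<dots> = ennreal (12 * r)"
    using r by (simp flip: ennreal_plus)
  finally have "emeasure circle_measure (unit_circle \<inter> cball \<zeta> r) \<le> ennreal (12 * r) / ennreal (2 * pi)"
    by (subst emeasure_circle_measure) (auto simp: borel_circle_iff intro!: divide_right_mono_ennreal)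
  also have "\<dots> = ennreal (12 * r / (2 * pi))"
    using r by (subst divide_ennreal) auto
  also have "\<dots> \<le> ennreal (2 * r)"
    using r pi_gt3 mult_left_mono[of 3 pi r] by (intro ennreal_leI) (simp add: field_simps)
  finally show ?thesis .
qed

section \<open>Arcs seen in an arbitrary angular window\<close>

lemma emeasure_lborel_shift:
  fixes A :: "real set"
  assumes [measurable]: "A \<in> sets borel"
  shows "emeasure lborel {s. s + c \<in> A} = emeasure lborel A"
proof -
  have "emeasure lborel A = emeasure (distr lborel borel ((+) c)) A"
    by (simp add: lborel_distr_plus)
  also have "\<dots> = emeasure lborel {s. s + c \<in> A}"
    by (subst emeasure_distr) (auto simp: vimage_def add.commute)
  finally show ?thesis by simp
qed

text \<open>\<open>circle_measure\<close> refers to the window [0, 2 pi), while an arc may start at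
  any angle a. The window at a is cut at the first multiple of 2 pi beyond a, and the two pieces are
  translated back so as to fill [0, 2 pi).\<close>

lemma emeasure_cis_period:
  assumes B: "B \<in> sets borel"
  shows "emeasure lborel {s \<in> {a..<a + 2 * pi}. cis s \<in> B} =
         emeasure lborel {s \<in> {0..<2 * pi}. cis s \<in> B}"
proof -
  define n :: int where "n = \<lfloor>a / (2 * pi)\<rfloor>"
  define c where "c = 2 * pi * of_int n"
  have c: "c \<le> a" "a < c + 2 * pi"
    using floor_divide_lower[of "2 * pi" a] floor_divide_upper[of "2 * pi" a]
    by (simp_all add: c_def n_def algebra_simps)
  have cis_c: "cis (s + c) = cis s" "cis (s + (c + 2 * pi)) = cis s" for s
    by (simp_all add: c_def flip: cis_mult)
  note cis_c = cis_c cis_c(2)[unfolded mult.commute[of 2 pi]]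
  have [measurable]: "{s. cis s \<in> B} \<in> sets borel"
    using measurable_sets[OF measurable_cis B] by (simp add: vimage_def)
  let ?P = "\<lambda>I. {s \<in> I. cis s \<in> B}"
  have m [measurable]: "?P I \<in> sets borel" if "I \<in> sets borel" for I
  proof -
    have "?P I = I \<inter> {s. cis s \<in> B}" by auto
    with that show ?thesis by simp
  qed
  have 1: "emeasure lborel (?P {a..<c + 2 * pi}) = emeasure lborel (?P {a - c..<2 * pi})"
    by (subst emeasure_lborel_shift[of "?P {a..<c + 2 * pi}" c, symmetric], simp)
       (simp add: cis_c algebra_simps)
  have 2: "emeasure lborel (?P {c + 2 * pi..<a + 2 * pi}) = emeasure lborel (?P {0..<a - c})"
    by (subst emeasure_lborel_shift[of "?P {c + 2 * pi..<a + 2 * pi}" "c + 2 * pi", symmetric], simp)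
       (simp add: cis_c algebra_simps)
  have "emeasure lborel (?P {a..<a + 2 * pi}) =
      emeasure lborel (?P {a..<c + 2 * pi} \<union> ?P {c + 2 * pi..<a + 2 * pi})"
    using c by (intro arg_cong[where f="emeasure lborel"]) auto
  also have "\<dots> = emeasure lborel (?P {a..<c + 2 * pi}) + emeasure lborel (?P {c + 2 * pi..<a + 2 * pi})"
    by (rule plus_emeasure[symmetric]) auto
  also have "\<dots> = emeasure lborel (?P {a - c..<2 * pi}) + emeasure lborel (?P {0..<a - c})"
    unfolding 1 2 ..
  also have "\<dots> = emeasure lborel (?P {a - c..<2 * pi} \<union> ?P {0..<a - c})"
    by (rule plus_emeasure) auto
  also have "\<dots> = emeasure lborel (?P {0..<2 * pi})"
    using c by (intro arg_cong[where f="emeasure lborel"]) auto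
  finally show ?thesis .
qed

text \<open>J differs from the open interval by at most two points, so its image is a relatively
  open set together with a finite one.\<close>

lemma cis_image_sets_circle_measure:
  fixes J :: "real set"
  assumes "{a<..<b} \<subseteq> J" "J \<subseteq> {a..b}"
  shows "cis ` J \<in> sets circle_measure"
proof -
  have J: "J = {a<..<b} \<union> J \<inter> {a, b}"
    using assms by fastforce
  have fin: "finite (J \<inter> {a, b})" by auto
  have "cis ` J = cis ` {a<..<b} \<union> cis ` (J \<inter> {a, b})"
    by (subst J) (simp only: image_Un)
  moreover have "cis ` {a<..<b} \<in> sets circle_measure"
    by (intro openin_circle_sets openin_cis_image) auto
  moreover have "cis ` (J \<inter> {a, b}) \<in> sets circle_measure"
    unfolding borel_circle_iff
    using finite_imp_closed[OF finite_imageI[OF fin, of cis]] by auto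
  ultimately show ?thesis by auto
qed

text \<open>In the window [a, a + 2 pi) the angles that \<open>cis\<close> sends into the arc form a
  set squeezed between (a, b) and [a, b], whichever endpoints J contains.\<close>

lemma emeasure_circle_arc:
  assumes ab: "a < b" "b \<le> a + 2 * pi" and J: "{a<..<b} \<subseteq> J" "J \<subseteq> {a..b}"
  shows "emeasure circle_measure (cis ` J) = ennreal ((b - a) / (2 * pi))"
proof -
  note m = cis_image_sets_circle_measure[OF J]
  let ?S = "{s \<in> {a..<a + 2 * pi}. cis s \<in> cis ` J}"
  have mS: "?S \<in> sets borel"
  proof -
    have "?S = {a..<a + 2 * pi} \<inter> (cis -` (cis ` J))" by auto
    then show ?thesis
      using measurable_sets[OF measurable_cis, of "cis ` J"] m by (auto simp: borel_circle_iff)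
  qed
  have "?S \<subseteq> {a..b}"
  proof
    fix s assume s: "s \<in> ?S"
    then obtain j where j: "j \<in> J" "cis s = cis j" by auto
    then have "sin s = sin j \<and> cos s = cos j" by (simp add: complex_eq_iff)
    then obtain k :: int where k: "s = j + 2 * pi * k" using sin_cos_eq_iff by blast
    have "a \<le> j" "j \<le> b" "a \<le> s" "s < a + 2 * pi" using s j(1) J by auto
    then have *: "- (2 * pi) \<le> 2 * pi * k" "2 * pi * k < 2 * pi" using ab(2) k by linarith+
    have "2 * pi * of_int (- 1) \<le> 2 * pi * of_int k" using *(1) by simp
    then have "- 1 \<le> k" by (subst (asm) mult_le_cancel_left_pos) (simp, linarith)
    moreover have "2 * pi * of_int k < 2 * pi * of_int 1" using *(2) by simp
    then have "k < 1" by (subst (asm) mult_less_cancel_left_pos) (simp, linarith)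
    ultimately consider "k = 0" | "k = -1" by linarith
    then show "s \<in> {a..b}"
    proof cases
      case 1 then show ?thesis using k j J by auto
    next
      \<comment> \<open>Only the full circle allows this wrap-around: j = b = a + 2 pi, and then s =
        a.\<close>
      case 2 then show ?thesis using k j(1) J ab s by auto
    qed
  qed
  then have "emeasure lborel ?S \<le> emeasure lborel {a..b}" by (intro emeasure_mono) auto
  moreover have "emeasure lborel {a<..<b} \<le> emeasure lborel ?S"
    using ab J by (intro emeasure_mono) (use mS in auto)
  ultimately have "emeasure lborel ?S = ennreal (b - a)" using ab by (simp add: antisym)
  then have "emeasure lborel {s \<in> {0..<2 * pi}. cis s \<in> cis ` J} = ennreal (b - a)"
    using emeasure_cis_period[of "cis ` J" a] m by (simp add: borel_circle_iff)
  then show ?thesis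
    using ab by (subst emeasure_circle_measure[OF m]) (simp add: divide_ennreal)
qed

section \<open>Lower semicontinuity and decay of the maximal functions\<close>

text \<open>Arcs in the supremum may thus be taken relatively open, which makes the maximal function
  lower semicontinuous.\<close>

lemma circle_arc_enlarge:
  assumes I: "I \<in> circle_arcs" and x: "x \<in> I"
    and less: "t < c * ((\<integral>\<^sup>+\<zeta>\<in>I. f \<zeta> \<partial>circle_measure) / emeasure circle_measure I)"
  obtains I' where "I' \<in> circle_arcs" "openin (top_of_set unit_circle) I'" "x \<in> I'"
    "t < c * ((\<integral>\<^sup>+\<zeta>\<in>I'. f \<zeta> \<partial>circle_measure) / emeasure circle_measure I')"
proof -
  obtain J a b where J: "I = cis ` J" "a < b" "b \<le> a + 2 * pi" "{a<..<b} \<subseteq> J" "J \<subseteq> {a..b}"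
    using I by (auto simp: circle_arcs_def)
  define N where "N = (\<integral>\<^sup>+\<zeta>\<in>I. f \<zeta> \<partial>circle_measure)"
  have eI: "emeasure circle_measure I = ennreal ((b - a) / (2 * pi))"
    unfolding J(1) by (rule emeasure_circle_arc) (use J in auto)
  have mono: "N \<le> (\<integral>\<^sup>+\<zeta>\<in>I'. f \<zeta> \<partial>circle_measure)" if "I \<subseteq> I'" for I'
    unfolding N_def using that by (intro nn_integral_mono) (auto split: split_indicator)
  show ?thesis
  proof (cases "b = a + 2 * pi")
    case True
    \<comment> \<open>The full circle is open in itself, but J may miss its endpoint. Closing the
      interval leaves the measure unchanged and can only increase the integral.\<close>
    let ?I = "cis ` {a..b}"
    have e: "emeasure circle_measure ?I = emeasure circle_measure I"
      unfolding eI by (rule emeasure_circle_arc) (use J in auto)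
    have full: "?I = unit_circle"
    proof
      show "unit_circle \<subseteq> ?I"
      proof
        fix y assume "y \<in> unit_circle"
        then obtain s where s: "0 \<le> s" "s < 2 * pi" "y = cis s" by (rule unit_circle_cisE)
        define n where "n = \<lfloor>(s - a) / (2 * pi)\<rfloor>"
        have "2 * pi * of_int n \<le> s - a" "s - a < 2 * pi * of_int n + 2 * pi"
          using floor_divide_lower[of "2 * pi" "s - a"] floor_divide_upper[of "2 * pi" "s - a"]
          by (simp_all add: n_def algebra_simps)
        then have "s - 2 * pi * of_int n \<in> {a..b}" using True by auto
        moreover have "y = cis (s - 2 * pi * of_int n)"
          by (simp add: s flip: cis_divide)
        ultimately show "y \<in> ?I" by blast
      qed
    qed auto
    show ?thesis
    proof (rule that[of ?I])
      show "?I \<in> circle_arcs"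
        unfolding circle_arcs_def
        by (rule CollectI, rule exI[of _ "{a..b}"], rule exI[of _ a], rule exI[of _ b]) (use J(2,3) in auto)
      show "openin (top_of_set unit_circle) ?I" unfolding full by simp
      show "x \<in> ?I" using x J by auto
      have "N \<le> (\<integral>\<^sup>+\<zeta>\<in>?I. f \<zeta> \<partial>circle_measure)" by (rule mono) (use J in auto)
      then show "t < c * ((\<integral>\<^sup>+\<zeta>\<in>?I. f \<zeta> \<partial>circle_measure) / emeasure circle_measure ?I)"
        unfolding e by (intro less_le_trans[OF less] mult_left_mono divide_right_mono_ennreal)
          (auto simp: N_def)
    qed
  next
    case False
    then have b: "b < a + 2 * pi" using J by auto
    define s where "s = (b - a) / (2 * pi)"
    have s: "s > 0" using J by (simp add: s_def)
    have less': "t < c * N / ennreal s"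
      using less unfolding eI N_def[symmetric] s_def by (simp add: ennreal_times_divide)
    \<comment> \<open>Here s and s + e are the normalized lengths of the old and the new arc. Since
      c * N / (s + e) tends to c * N / s as e decreases to 0, the strict inequality survives for all
      small e; an infinite c * N is treated apart.\<close>
    have "\<exists>e0>0. \<forall>e. 0 < e \<and> e < e0 \<longrightarrow> t < c * N / ennreal (s + e)"
    proof (cases "c * N = top")
      case True
      then show ?thesis using less' s
        by (intro exI[of _ 1]) (auto simp: ennreal_top_divide less_top[symmetric])
    next
      case False
      then obtain d where d: "d \<ge> 0" "c * N = ennreal d" by (cases "c * N") auto
      have "t < ennreal (d / s)" using less' d s by (simp add: divide_ennreal)
      then obtain u where u: "u \<ge> 0" "t = ennreal u" by (cases t) auto
      have "u < d / s" using \<open>t < ennreal (d / s)\<close> u by (simp add: ennreal_less_iff)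
      then have us: "u * s < d" using s by (simp add: field_simps)
      \<comment> \<open>The inequality amounts to e * u < d - u * s. The denominator u + 1 in place
        of u avoids a division by zero.\<close>
      have "u < d / (s + e)" if "0 < e" "e < (d - u * s) / (u + 1)" for e
      proof -
        have "e * (u + 1) < d - u * s" using that(2) u by (simp add: field_simps)
        then have "u * (s + e) < d" using that(1) by (simp add: algebra_simps)
        then show ?thesis using s that by (simp add: field_simps)
      qed
      then show ?thesis using us u d s
        by (intro exI[of _ "(d - u * s) / (u + 1)"]) (auto simp: divide_ennreal ennreal_less_iff simp del: ennreal_plus)
    qed
    then obtain e0 where e0: "e0 > 0" "\<And>e. 0 < e \<Longrightarrow> e < e0 \<Longrightarrow> t < c * N / ennreal (s + e)"
      by blast
    \<comment> \<open>Moving both ends out by pi * e adds e to the normalized length. The second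
      entry of the minimum keeps the new arc within one turn.\<close>
    define e where "e = min (e0 / 2) ((a + 2 * pi - b) / (2 * pi))"
    have e: "0 < e" "e < e0" "2 * pi * e \<le> a + 2 * pi - b"
    proof -
      show "0 < e" "e < e0" using e0 b by (auto simp: e_def)
      have "e \<le> (a + 2 * pi - b) / (2 * pi)" by (simp add: e_def)
      then show "2 * pi * e \<le> a + 2 * pi - b" by (simp add: field_simps)
    qed
    let ?K = "{a - pi * e<..<b + pi * e}"
    have pe: "pi * e > 0" using e by simp
    have eK: "emeasure circle_measure (cis ` ?K) = ennreal (s + e)"
    proof -
      have "emeasure circle_measure (cis ` ?K) = ennreal (((b + pi * e) - (a - pi * e)) / (2 * pi))"
        using pe e(3) J(2) by (intro emeasure_circle_arc) auto
      also have "((b + pi * e) - (a - pi * e)) / (2 * pi) = s + e"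
        by (simp add: s_def field_simps)
      finally show ?thesis .
    qed
    have JK: "J \<subseteq> ?K" using J(5) pe by fastforce
    show ?thesis
    proof (rule that[of "cis ` ?K"])
      show "cis ` ?K \<in> circle_arcs"
        unfolding circle_arcs_def
      proof (rule CollectI, intro exI conjI)
        show "cis ` ?K = cis ` ?K" ..
        show "a - pi * e < b + pi * e" "b + pi * e \<le> a - pi * e + 2 * pi" using J(2) pe e(3) by auto
      qed auto
      show "openin (top_of_set unit_circle) (cis ` ?K)" by (rule openin_cis_image) auto
      show "x \<in> cis ` ?K" using x J(1) JK by auto
      have "N \<le> (\<integral>\<^sup>+\<zeta>\<in>cis ` ?K. f \<zeta> \<partial>circle_measure)" by (rule mono) (use J(1) JK in auto)
      then show "t < c * ((\<integral>\<^sup>+\<zeta>\<in>cis ` ?K. f \<zeta> \<partial>circle_measure) / emeasure circle_measure (cis ` ?K))"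
        unfolding eK ennreal_times_divide
        by (intro less_le_trans[OF e0(2)[OF e(1,2)]] mult_left_mono divide_right_mono_ennreal) auto
    qed
  qed
qed

lemma circle_arcs_subset: "I \<in> circle_arcs \<Longrightarrow> I \<subseteq> unit_circle"
  by (auto simp: circle_arcs_def)

text \<open>An arc that witnesses the inequality at x witnesses it at each of its points, and after
  enlargement it is open.\<close>

lemma openin_mult_hl_maximal_greater:
  "openin (top_of_set unit_circle) {x \<in> unit_circle. t < c * hl_maximal f x}"
proof -
  let ?q = "\<lambda>I. c * ((\<integral>\<^sup>+\<zeta>\<in>I. f \<zeta> \<partial>circle_measure) / emeasure circle_measure I)"
  have "{x \<in> unit_circle. t < c * hl_maximal f x} =
      \<Union>{I \<in> circle_arcs. openin (top_of_set unit_circle) I \<and> t < ?q I}" (is "?L = ?R")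
  proof
    show "?L \<subseteq> ?R"
    proof
      fix x assume "x \<in> ?L"
      then obtain I where I: "I \<in> circle_arcs" "x \<in> I" "t < ?q I"
        by (auto simp: hl_maximal_def SUP_mult_left_ennreal less_SUP_iff)
      show "x \<in> ?R"
        by (rule circle_arc_enlarge[OF I]) auto
    qed
    show "?R \<subseteq> ?L"
    proof
      fix x assume "x \<in> ?R"
      then obtain I where I: "I \<in> circle_arcs" "x \<in> I" "t < ?q I" by blast
      then have "t < c * hl_maximal f x"
        unfolding hl_maximal_def SUP_mult_left_ennreal less_SUP_iff by blast
      with I circle_arcs_subset show "x \<in> ?L" by blast
    qed
  qed
  then show ?thesis by (auto intro: openin_Union)
qed

text \<open>Openness, unlike measurability, survives the uncountable union over z.\<close>

lemma openin_shadow_maximal_greater: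
  "openin (top_of_set unit_circle) {x \<in> unit_circle. t < shadow_maximal \<alpha> \<phi> x}"
proof -
  have "{x \<in> unit_circle. t < shadow_maximal \<alpha> \<phi> x} =
      (\<Union>z\<in>unit_disc. {x \<in> unit_circle.
         t < ennreal (\<phi> z) * hl_maximal (indicator (privalov_shadow \<alpha> z)) x})"
    by (auto simp: shadow_maximal_def less_SUP_iff)
  then show ?thesis
    using openin_mult_hl_maximal_greater by (auto simp del: mem_sphere_0 intro!: openin_Union)
qed

lemma shadow_maximal_greater_sets:
  "{x \<in> unit_circle. t < shadow_maximal \<alpha> \<phi> x} \<in> sets circle_measure"
  by (rule openin_circle_sets[OF openin_shadow_maximal_greater])

lemma borel_measurable_shadow_maximal:
  "shadow_maximal \<alpha> \<phi> \<in> borel_measurable circle_measure"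
  using shadow_maximal_greater_sets
  by (intro borel_measurableI_greater) (simp add: space_circle_measure)

lemma borel_measurable_completion_shadow_maximal:
  "(\<lambda>\<zeta>. enn2ereal (shadow_maximal \<alpha> \<phi> \<zeta>)) \<in> borel_measurable (completion circle_measure)"
  by (intro measurable_completion measurable_compose[OF borel_measurable_shadow_maximal]
      measurable_enn2ereal)

lemma circle_tail_shadow_maximal:
  assumes "0 \<le> t"
  shows "circle_tail (\<lambda>\<zeta>. enn2ereal (shadow_maximal \<alpha> \<phi> \<zeta>)) t =
    emeasure circle_measure {\<zeta> \<in> unit_circle. ennreal t < shadow_maximal \<alpha> \<phi> \<zeta>}"
proof -
  have "ereal t < \<bar>enn2ereal x\<bar> \<longleftrightarrow> ennreal t < x" for x
    using assms by (simp add: less_ennreal.rep_eq enn2ereal_ennreal)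
  then show ?thesis
    unfolding circle_tail_def 
    by (simp only: emeasure_completion[OF sets_completionI_sets[OF shadow_maximal_greater_sets]]
        main_part[OF shadow_maximal_greater_sets])
qed

text \<open>The shadow is a ball of radius at most 2 * \<alpha> * \<delta> about z, cut with the
  circle, so its part in I has measure m at most 8 * \<alpha> * \<delta>. If I contains \<zeta> and
  meets the shadow at \<eta>, its angular length is at least |\<zeta> - \<eta>|, hence at least d -
  2 * \<alpha> * \<delta>: a distant arc must be long, and its average is small.\<close>

lemma hl_maximal_shadow_le:
  assumes \<alpha>: "\<alpha> \<ge> 1" and z: "z \<in> unit_disc" and \<zeta>: "\<zeta> \<in> unit_circle"
  shows "hl_maximal (indicator (privalov_shadow \<alpha> z)) \<zeta>
    \<le> ennreal (66 * \<alpha> * ((1 - cmod z) / cmod (\<zeta> - z)))"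
  unfolding hl_maximal_def
proof (rule SUP_least, clarify)
  fix I assume I: "I \<in> circle_arcs" "\<zeta> \<in> I"
  let ?S = "privalov_shadow \<alpha> z"
  define \<delta> where "\<delta> = 1 - cmod z"
  define d where "d = cmod (\<zeta> - z)"
  have \<delta>: "\<delta> > 0" using z by (simp add: \<delta>_def)
  have d: "d \<ge> \<delta>" using norm_triangle_ineq2[of \<zeta> z] \<zeta> by (simp add: d_def \<delta>_def)
  obtain J a b where J: "I = cis ` J" "a < b" "b \<le> a + 2 * pi" "{a<..<b} \<subseteq> J" "J \<subseteq> {a..b}"
    using I by (auto simp: circle_arcs_def)
  define s where "s = (b - a) / (2 * pi)"
  have s: "s > 0" using J by (simp add: s_def)
  have eI: "emeasure circle_measure I = ennreal s"
    unfolding J(1) s_def by (rule emeasure_circle_arc) (use J in auto)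
  have mI: "I \<in> sets circle_measure"
    unfolding J(1) by (rule cis_image_sets_circle_measure) (use J in auto)
  have S: "?S = unit_circle \<inter> cball z (\<alpha> * (1 - (cmod z)\<^sup>2))"
    using z by (auto simp: privalov_shadow_def stolz_angle_def dist_norm)
  have mS: "?S \<in> sets circle_measure"
    unfolding S borel_circle_iff by auto
  have int: "(\<integral>\<^sup>+\<xi>\<in>I. indicator ?S \<xi> \<partial>circle_measure) = emeasure circle_measure (I \<inter> ?S)"
    using mS mI by (simp add: mult.commute flip: indicator_inter_arith)
  have "emeasure circle_measure (I \<inter> ?S) / ennreal s \<le> ennreal (66 * \<alpha> * (\<delta> / d))"
  proof (cases "I \<inter> ?S = {}")
    case False
    then obtain \<eta> where \<eta>: "\<eta> \<in> I" "\<eta> \<in> ?S" by auto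
    have "1 - (cmod z)\<^sup>2 = \<delta> * (1 + cmod z)" by (simp add: \<delta>_def power2_eq_square algebra_simps)
    also have "\<dots> \<le> \<delta> * 2" using z \<delta> by (intro mult_left_mono) auto
    finally have "\<alpha> * (1 - (cmod z)\<^sup>2) \<le> \<alpha> * (\<delta> * 2)" using \<alpha> by (intro mult_left_mono) auto
    then have R: "\<alpha> * (1 - (cmod z)\<^sup>2) \<le> 2 * \<alpha> * \<delta>" by simp
    have "I \<inter> ?S \<subseteq> unit_circle \<inter> cball \<eta> (4 * \<alpha> * \<delta>)"
    proof
      fix \<xi> assume "\<xi> \<in> I \<inter> ?S"
      then have "\<xi> \<in> unit_circle" "dist z \<xi> \<le> 2 * \<alpha> * \<delta>" using R by (auto simp: S)
      moreover have "dist z \<eta> \<le> 2 * \<alpha> * \<delta>" using \<eta> R by (auto simp: S)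
      ultimately show "\<xi> \<in> unit_circle \<inter> cball \<eta> (4 * \<alpha> * \<delta>)"
        using dist_triangle3[of \<eta> \<xi> z] by auto
    qed
    then have "emeasure circle_measure (I \<inter> ?S) \<le> emeasure circle_measure (unit_circle \<inter> cball \<eta> (4 * \<alpha> * \<delta>))"
      by (intro emeasure_mono) (auto simp: borel_circle_iff)
    also have "\<dots> \<le> ennreal (2 * (4 * \<alpha> * \<delta>))"
      using \<eta> \<alpha> \<delta> by (intro emeasure_circle_cball_le) (auto simp: S)
    finally have le1: "emeasure circle_measure (I \<inter> ?S) \<le> ennreal (8 * \<alpha> * \<delta>)" by (simp add: mult.assoc)
    have le2: "emeasure circle_measure (I \<inter> ?S) \<le> ennreal s"
      unfolding eI[symmetric] by (intro emeasure_mono mI) auto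
    obtain m where m: "m \<ge> 0" "emeasure circle_measure (I \<inter> ?S) = ennreal m"
      using le1 by (cases "emeasure circle_measure (I \<inter> ?S)") (auto simp: top_unique)
    have ms: "m \<le> s" using le2 m s by simp
    have m\<delta>: "m \<le> 8 * \<alpha> * \<delta>" using le1 m \<alpha> \<delta> by simp
    obtain i j where ij: "i \<in> J" "\<zeta> = cis i" "j \<in> J" "\<eta> = cis j" using I \<eta> J(1) by auto
    have "cmod (\<zeta> - \<eta>) \<le> b - a"
    proof -
      have "i \<in> {a..b}" "j \<in> {a..b}" using ij J(5) by auto
      then have "\<bar>i - j\<bar> \<le> b - a" by auto
      then show ?thesis using cmod_cis_diff_le[of i j] ij by simp
    qed
    also have "\<dots> = 2 * pi * s" by (simp add: s_def)
    also have "\<dots> \<le> 8 * s" using pi_less_4 s by (intro mult_right_mono) auto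
    finally have "d \<le> 8 * s + 2 * \<alpha> * \<delta>"
      using norm_triangle_ineq[of "\<zeta> - \<eta>" "\<eta> - z"] \<eta> R
      by (auto simp: S d_def dist_norm norm_minus_commute)
    \<comment> \<open>The factor m is estimated by 8 * \<alpha> * \<delta> in the first summand and
      by s in the second, so 8 * 8 + 2 yields 66.\<close>
    then have "m * d \<le> m * (8 * s) + m * (2 * \<alpha> * \<delta>)"
      using m by (simp add: mult_left_mono flip: distrib_left)
    also have "\<dots> \<le> 8 * \<alpha> * \<delta> * (8 * s) + s * (2 * \<alpha> * \<delta>)"
      using m\<delta> ms s \<alpha> \<delta> by (intro add_mono mult_right_mono) auto
    finally have "m / s \<le> 66 * \<alpha> * (\<delta> / d)"
      using s \<delta> d by (simp add: field_simps)
    then show ?thesis unfolding m(2) using m s by (simp add: divide_ennreal ennreal_leI)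
  qed simp
  then show "(\<integral>\<^sup>+\<xi>\<in>I. indicator ?S \<xi> \<partial>circle_measure) / emeasure circle_measure I
      \<le> ennreal (66 * \<alpha> * ((1 - cmod z) / cmod (\<zeta> - z)))"
    unfolding int eI d_def \<delta>_def .
qed

section \<open>Poisson integrals and the covering argument\<close>

text \<open>With \<delta> = 1 - |z| and q = |\<xi> - z|, the product is at most 2 \<delta>^2 / (q^2
  d). The least admissible k is taken. If k = j + 1, then \<xi> is farther than 2^(j+1) d from
  \<zeta>, so q is at least 2^j d, hence at least 2^j \<delta>, and a factor 4^(-j) is gained. If k
  = 0, the inequality \<delta> \<le> q suffices.\<close>

lemma poisson_kernel_dyadic_bound:
  assumes z: "z \<in> unit_disc" and \<zeta>: "\<zeta> \<in> unit_circle" and \<xi>: "\<xi> \<in> unit_circle"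
  defines "d \<equiv> cmod (\<zeta> - z)"
  shows "\<exists>k::nat. cmod (\<xi> - \<zeta>) \<le> 2 ^ (k + 1) * d \<and>
    (1 - (cmod z)\<^sup>2) / (cmod (\<xi> - z))\<^sup>2 * ((1 - cmod z) / d) \<le> 8 / (4 ^ k * d)"
proof -
  define \<delta> where "\<delta> = 1 - cmod z"
  define q where "q = cmod (\<xi> - z)"
  have \<delta>: "\<delta> > 0" using z by (simp add: \<delta>_def)
  have d: "d \<ge> \<delta>" using norm_triangle_ineq2[of \<zeta> z] \<zeta> by (simp add: d_def \<delta>_def)
  have q: "q \<ge> \<delta>" using norm_triangle_ineq2[of \<xi> z] \<xi> by (simp add: q_def \<delta>_def)
  have "1 - (cmod z)\<^sup>2 = \<delta> * (1 + cmod z)" by (simp add: \<delta>_def power2_eq_square algebra_simps)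
  also have "\<dots> \<le> \<delta> * 2" using z \<delta> by (intro mult_left_mono) auto
  finally have "(1 - (cmod z)\<^sup>2) / q\<^sup>2 * (\<delta> / d) \<le> \<delta> * 2 / q\<^sup>2 * (\<delta> / d)"
    using \<delta> d by (intro mult_right_mono divide_right_mono) auto
  also have "\<dots> = 2 * \<delta>\<^sup>2 / (q\<^sup>2 * d)" by (simp add: power2_eq_square)
  finally have le: "(1 - (cmod z)\<^sup>2) / q\<^sup>2 * (\<delta> / d) \<le> 2 * \<delta>\<^sup>2 / (q\<^sup>2 * d)" .
  have ex: "\<exists>k::nat. cmod (\<xi> - \<zeta>) \<le> 2 ^ (k + 1) * d"
  proof -
    obtain k :: nat where "cmod (\<xi> - \<zeta>) / d < 2 ^ k"
      using real_arch_pow[of 2] by auto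
    then have "cmod (\<xi> - \<zeta>) < 2 ^ k * d" using d \<delta> by (simp add: field_simps)
    also have "\<dots> \<le> 2 ^ (k + 1) * d" using d \<delta> by simp
    finally show ?thesis by (auto intro: less_imp_le)
  qed
  define k where "k = (LEAST k. cmod (\<xi> - \<zeta>) \<le> 2 ^ (k + 1) * d)"
  have k: "cmod (\<xi> - \<zeta>) \<le> 2 ^ (k + 1) * d"
    unfolding k_def by (rule LeastI_ex[OF ex])
  have "2 * \<delta>\<^sup>2 / (q\<^sup>2 * d) \<le> 8 / (4 ^ k * d)"
  proof (cases k)
    case 0
    have "\<delta>\<^sup>2 \<le> q\<^sup>2" using q \<delta> by (intro power_mono) auto
    moreover have "0 < q\<^sup>2" using q \<delta> by simp
    ultimately have "\<delta>\<^sup>2 \<le> 4 * q\<^sup>2" "q\<^sup>2 > 0" by linarith+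
    then have "2 * \<delta>\<^sup>2 / q\<^sup>2 \<le> 8" by (simp add: divide_le_eq)
    then have "2 * \<delta>\<^sup>2 / q\<^sup>2 / d \<le> 8 / d" using \<delta> d by (intro divide_right_mono) auto
    then show ?thesis using 0 by simp
  next
    case (Suc j)
    have "\<not> cmod (\<xi> - \<zeta>) \<le> 2 ^ (j + 1) * d"
      using not_less_Least[of j "\<lambda>k. cmod (\<xi> - \<zeta>) \<le> 2 ^ (k + 1) * d"] Suc k_def by auto
    then have far: "2 * (2 ^ j * d) < cmod (\<xi> - \<zeta>)" by simp
    have "d \<le> 2 ^ j * d" using \<delta> d mult_right_mono[of 1 "2 ^ j" d] by simp
    moreover have "cmod (\<xi> - \<zeta>) \<le> q + d"
      using norm_triangle_ineq4[of "\<xi> - z" "\<zeta> - z"] by (simp add: q_def d_def)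
    ultimately have "2 ^ j * d \<le> q" using far by linarith
    then have "(2 ^ j * d)\<^sup>2 \<le> q\<^sup>2" using \<delta> d by (intro power_mono) auto
    moreover have "(2 ^ j)\<^sup>2 = (4 :: real) ^ j"
      by (simp add: power2_eq_square flip: power_mult_distrib)
    ultimately have "4 ^ j * d\<^sup>2 \<le> q\<^sup>2" by (simp add: power_mult_distrib)
    moreover have "4 ^ j * \<delta>\<^sup>2 \<le> 4 ^ j * d\<^sup>2" using d \<delta> by (intro mult_left_mono power_mono) auto
    ultimately have "4 ^ j * \<delta>\<^sup>2 \<le> q\<^sup>2" by linarith
    moreover have "0 < q\<^sup>2" using q \<delta> by simp
    ultimately have "2 * \<delta>\<^sup>2 / q\<^sup>2 \<le> 8 / 4 ^ k" unfolding Suc by (simp add: field_simps)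
    then have "2 * \<delta>\<^sup>2 / q\<^sup>2 / d \<le> 8 / 4 ^ k / d" using \<delta> d by (intro divide_right_mono) auto
    then show ?thesis by simp
  qed
  with le k show ?thesis unfolding q_def \<delta>_def by (intro exI[of _ k]) auto
qed

lemma borel_measurable_poisson_kernel:
  "(\<lambda>\<xi>. (1 - (cmod z)\<^sup>2) / (cmod (\<xi> - z))\<^sup>2) \<in> borel_measurable circle_measure"
proof -
  have "(\<lambda>\<xi>. (1 - (cmod z)\<^sup>2) / (cmod (\<xi> - z))\<^sup>2) \<in> borel_measurable borel"
    by measurable
  then show ?thesis
    by (simp cong: measurable_cong_sets add: sets_circle_measure measurable_restrict_space1)
qed

text \<open>From one dyadic ball to the next the kernel bound drops by 4 while the bound on the mass
  grows by 2. The distance d cancels, and the terms 16 A / 2^k sum to 32 A.\<close>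

lemma poisson_nn_integral_bound:
  assumes M: "sets M = sets circle_measure" and A: "0 \<le> A"
    and growth: "\<And>r. 0 < r \<Longrightarrow> emeasure M (unit_circle \<inter> cball \<zeta> r) \<le> ennreal (A * r)"
    and z: "z \<in> unit_disc" and \<zeta>: "\<zeta> \<in> unit_circle"
  shows "(\<integral>\<^sup>+\<xi>. ennreal ((1 - (cmod z)\<^sup>2) / (cmod (\<xi> - z))\<^sup>2) \<partial>M)
      * ennreal ((1 - cmod z) / cmod (\<zeta> - z)) \<le> ennreal (32 * A)"
proof -
  define d where "d = cmod (\<zeta> - z)"
  have d: "d > 0" using z \<zeta> by (auto simp: d_def)
  have sp: "space M = unit_circle"
    using sets_eq_imp_space_eq[OF M] by (simp add: space_circle_measure)
  have meas [measurable]: "(\<lambda>\<xi>. (1 - (cmod z)\<^sup>2) / (cmod (\<xi> - z))\<^sup>2) \<in> borel_measurable M"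
    using borel_measurable_poisson_kernel by (simp cong: measurable_cong_sets add: M)
  have setB [measurable]: "unit_circle \<inter> cball \<zeta> r \<in> sets M" for r
    unfolding M borel_circle_iff by auto
  define B where "B = (\<lambda>k::nat. unit_circle \<inter> cball \<zeta> (2 ^ (k + 1) * d))"
  have [measurable]: "B k \<in> sets M" for k by (simp add: B_def)
  let ?f = "\<lambda>k \<xi>. ennreal (8 / (4 ^ k * d)) * indicator (B k) \<xi>"
  have single: "g k \<le> (\<Sum>k. g k)" for g :: "nat \<Rightarrow> ennreal" and k
    using sum_le_suminf[OF summableI, of "{k}" g] by simp
  have "(\<integral>\<^sup>+\<xi>. ennreal ((1 - (cmod z)\<^sup>2) / (cmod (\<xi> - z))\<^sup>2) \<partial>M) * ennreal ((1 - cmod z) / d)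
      = (\<integral>\<^sup>+\<xi>. ennreal ((1 - (cmod z)\<^sup>2) / (cmod (\<xi> - z))\<^sup>2) * ennreal ((1 - cmod z) / d) \<partial>M)"
    by (rule nn_integral_multc[symmetric]) simp
  also have "\<dots> \<le> (\<integral>\<^sup>+\<xi>. (\<Sum>k. ?f k \<xi>) \<partial>M)"
  proof (rule nn_integral_mono)
    fix \<xi> assume "\<xi> \<in> space M"
    then have \<xi>: "\<xi> \<in> unit_circle" by (simp add: sp)
    obtain k :: nat where k: "cmod (\<xi> - \<zeta>) \<le> 2 ^ (k + 1) * d"
      "(1 - (cmod z)\<^sup>2) / (cmod (\<xi> - z))\<^sup>2 * ((1 - cmod z) / d) \<le> 8 / (4 ^ k * d)"
      using poisson_kernel_dyadic_bound[OF z \<zeta> \<xi>] unfolding d_def by blast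
    have "ennreal ((1 - (cmod z)\<^sup>2) / (cmod (\<xi> - z))\<^sup>2) * ennreal ((1 - cmod z) / d)
        \<le> ennreal (8 / (4 ^ k * d))"
      using k(2) d z by (subst ennreal_mult[symmetric]) (auto simp: abs_square_le_1 intro!: ennreal_leI)
    also have "\<dots> = ?f k \<xi>"
      using k(1) \<xi> by (simp add: B_def dist_norm norm_minus_commute)
    also have "\<dots> \<le> (\<Sum>k. ?f k \<xi>)"
      by (rule single)
    finally show "ennreal ((1 - (cmod z)\<^sup>2) / (cmod (\<xi> - z))\<^sup>2) * ennreal ((1 - cmod z) / d)
        \<le> (\<Sum>k. ?f k \<xi>)" .
  qed
  also have "\<dots> = (\<Sum>k. \<integral>\<^sup>+\<xi>. ?f k \<xi> \<partial>M)"
    by (rule nn_integral_suminf) simp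
  also have "\<dots> \<le> (\<Sum>k. ennreal (16 * A * (1 / 2) ^ k))"
  proof (rule suminf_le)
    fix k
    have "(\<integral>\<^sup>+\<xi>. ?f k \<xi> \<partial>M) = ennreal (8 / (4 ^ k * d)) * emeasure M (B k)"
      by (rule nn_integral_cmult_indicator) simp
    also have "\<dots> \<le> ennreal (8 / (4 ^ k * d)) * ennreal (A * (2 ^ (k + 1) * d))"
      unfolding B_def using d by (intro mult_left_mono growth) auto
    also have "\<dots> = ennreal (8 / (4 ^ k * d) * (A * (2 ^ (k + 1) * d)))"
      using d A by (intro ennreal_mult[symmetric]) auto
    also have "8 / (4 ^ k * d) * (A * (2 ^ (k + 1) * d)) = 16 * A * (2 ^ k / 4 ^ k)"
      using d by (simp add: field_simps)
    also have "(2 :: real) ^ k / 4 ^ k = (1 / 2) ^ k"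
      by (simp flip: power_divide)
    finally show "(\<integral>\<^sup>+\<xi>. ?f k \<xi> \<partial>M) \<le> ennreal (16 * A * (1 / 2) ^ k)" .
  qed auto
  also have "\<dots> = ennreal (32 * A)"
    using A sums_mult[OF geometric_sums[of "1 / 2 :: real"], of "16 * A"]
    by (intro suminf_ennreal_eq) auto
  finally show ?thesis unfolding d_def .
qed

text \<open>Summation by \<open>count_space\<close> treats finite and infinite families alike, so
  the family of centres that Vitali's lemma provides needs no enumeration.\<close>

lemma emeasure_UN_countable_le:
  assumes C: "countable C" and m [measurable]: "\<And>i. i \<in> C \<Longrightarrow> X i \<in> sets M"
  shows "emeasure M (\<Union>i\<in>C. X i) \<le> (\<integral>\<^sup>+i. emeasure M (X i) \<partial>count_space C)"
proof -
  have [measurable]: "(\<Union>i\<in>C. X i) \<in> sets M" using C by (intro sets.countable_UN') auto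
  have "emeasure M (\<Union>i\<in>C. X i) = (\<integral>\<^sup>+x. indicator (\<Union>i\<in>C. X i) x \<partial>M)" by simp
  also have "\<dots> \<le> (\<integral>\<^sup>+x. (\<integral>\<^sup>+i. indicator (X i) x \<partial>count_space C) \<partial>M)"
  proof (rule nn_integral_mono)
    fix x
    show "indicator (\<Union>i\<in>C. X i) x \<le> (\<integral>\<^sup>+i. indicator (X i) x \<partial>count_space C)"
    proof (cases "x \<in> (\<Union>i\<in>C. X i)")
      case True
      then obtain j where j: "j \<in> C" "x \<in> X j" by auto
      have "(1::ennreal) = (\<integral>\<^sup>+i. indicator {j} i \<partial>count_space C)"
        using j by (simp add: nn_integral_indicator)
      also have "\<dots> \<le> (\<integral>\<^sup>+i. indicator (X i) x \<partial>count_space C)"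
        using j by (intro nn_integral_mono) (auto split: split_indicator)
      finally show ?thesis using True by simp
    qed simp
  qed
  also have "\<dots> = (\<integral>\<^sup>+i. (\<integral>\<^sup>+x. indicator (X i) x \<partial>M) \<partial>count_space C)"
    by (rule nn_integral_count_space_nn_integral[OF C]) auto
  also have "\<dots> = (\<integral>\<^sup>+i. emeasure M (X i) \<partial>count_space C)"
    by (intro nn_integral_cong) auto
  finally show ?thesis .
qed

text \<open>A dense ball has radius below its M-mass divided by A, and its fivefold enlargement has
  circle measure at most 10 r. The balls selected are disjoint, so their masses add up to at most
  the total mass. This is the weak-type (1,1) inequality for the maximal function of M over
  balls.\<close>

lemma emeasure_dense_points_le:
  assumes M: "sets M = sets circle_measure" and fin: "finite_measure M" and A: "0 < A"
    and E: "E \<subseteq> unit_circle"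
    and dense: "\<And>\<zeta>. \<zeta> \<in> E \<Longrightarrow> \<exists>r>0. ennreal (A * r) < emeasure M (unit_circle \<inter> cball \<zeta> r)"
  shows "emeasure circle_measure E \<le> ennreal (10 / A) * emeasure M unit_circle"
proof -
  interpret finite_measure M by (rule fin)
  have sp: "space M = unit_circle"
    using sets_eq_imp_space_eq[OF M] by (simp add: space_circle_measure)
  obtain r where r: "\<And>\<zeta>. \<zeta> \<in> E \<Longrightarrow> 0 < r \<zeta>"
      "\<And>\<zeta>. \<zeta> \<in> E \<Longrightarrow> ennreal (A * r \<zeta>) < emeasure M (unit_circle \<inter> cball \<zeta> (r \<zeta>))"
    using dense by metis
  have setB: "unit_circle \<inter> cball \<zeta> s \<in> sets circle_measure" for \<zeta> s
    unfolding borel_circle_iff by auto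
  \<comment> \<open>Vitali's lemma asks for bounded radii; at a dense ball A * r cannot exceed the
    total mass.\<close>
  define R where "R = measure M unit_circle / A"
  have bound: "0 < r \<zeta> \<and> r \<zeta> \<le> R" if "\<zeta> \<in> E" for \<zeta>
  proof -
    have "ennreal (A * r \<zeta>) \<le> emeasure M unit_circle"
      using r(2)[OF that] sp emeasure_space[of M "unit_circle \<inter> cball \<zeta> (r \<zeta>)"] by simp
    then have "A * r \<zeta> \<le> measure M unit_circle"
      by (simp add: emeasure_eq_measure)
    then show ?thesis using r(1)[OF that] A by (simp add: R_def field_simps)
  qed
  have "E \<subseteq> (\<Union>\<zeta>\<in>E. cball \<zeta> (r \<zeta>))"
    using r(1) by (force intro: less_imp_le)
  then obtain C where C: "countable C" "C \<subseteq> E"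
      "pairwise (\<lambda>i j. disjnt (cball i (r i)) (cball j (r j))) C"
      "E \<subseteq> (\<Union>i\<in>C. cball i (5 * r i))"
    using bound by (rule Vitali_covering_lemma_cballs[of E "\<lambda>i. i" r E R])
  have [simp]: "(\<Union>i\<in>C. unit_circle \<inter> cball i (s i)) \<in> sets circle_measure" for s
    using C(1) setB by (intro sets.countable_UN') auto
  have "emeasure circle_measure E \<le> emeasure circle_measure (\<Union>i\<in>C. unit_circle \<inter> cball i (5 * r i))"
    by (rule emeasure_mono) (use C(4) E in blast, simp del: UN_simps)
  also have "\<dots> \<le> (\<integral>\<^sup>+i. emeasure circle_measure (unit_circle \<inter> cball i (5 * r i)) \<partial>count_space C)"
    by (rule emeasure_UN_countable_le[OF C(1)]) (rule setB)
  also have "\<dots> \<le> (\<integral>\<^sup>+i. ennreal (10 / A) * emeasure M (unit_circle \<inter> cball i (r i)) \<partial>count_space C)"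
  proof (rule nn_integral_mono)
    fix i assume "i \<in> space (count_space C)"
    then have i: "i \<in> E" using C(2) by auto
    have "emeasure circle_measure (unit_circle \<inter> cball i (5 * r i)) \<le> ennreal (2 * (5 * r i))"
      using i E r(1)[OF i] by (intro emeasure_circle_cball_le) auto
    also have "2 * (5 * r i) = 10 / A * (A * r i)" using A by simp
    also have "ennreal (10 / A * (A * r i)) = ennreal (10 / A) * ennreal (A * r i)"
      using A r(1)[OF i] by (intro ennreal_mult) auto
    also have "\<dots> \<le> ennreal (10 / A) * emeasure M (unit_circle \<inter> cball i (r i))"
      using r(2)[OF i] by (intro mult_left_mono) auto
    finally show "emeasure circle_measure (unit_circle \<inter> cball i (5 * r i))
        \<le> ennreal (10 / A) * emeasure M (unit_circle \<inter> cball i (r i))" .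
  qed
  also have "\<dots> = ennreal (10 / A) * (\<integral>\<^sup>+i. emeasure M (unit_circle \<inter> cball i (r i)) \<partial>count_space C)"
    by (rule nn_integral_cmult) simp
  also have "(\<integral>\<^sup>+i. emeasure M (unit_circle \<inter> cball i (r i)) \<partial>count_space C)
      = emeasure M (\<Union>i\<in>C. unit_circle \<inter> cball i (r i))"
    using C(1,3) setB unfolding M[symmetric]
    by (intro emeasure_UN_countable[symmetric])
       (auto simp: disjoint_family_on_def pairwise_def disjnt_def)
  also have "\<dots> \<le> emeasure M unit_circle"
    using emeasure_space[of M] by (simp add: sp)
  finally show ?thesis by (simp add: mult_left_mono)
qed

section \<open>Poisson formula for dilations of positive harmonic functions\<close>

lemma has_real_derivative_horizontal:
  assumes "(h has_derivative (\<lambda>w. a * Re w + b * Im w)) (at (c + of_real u))"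
  shows "((\<lambda>u. h (c + of_real u)) has_real_derivative a) (at u)"
proof -
  have "((\<lambda>u. c + complex_of_real u) has_derivative (\<lambda>t. of_real t)) (at u)"
    by (auto intro!: derivative_eq_intros)
  from has_derivative_compose[OF this assms] show ?thesis
    by (simp add: has_field_derivative_def mult_commute_abs)
qed

lemma has_real_derivative_vertical:
  assumes "(h has_derivative (\<lambda>w. a * Re w + b * Im w)) (at (c + \<i> * of_real u))"
  shows "((\<lambda>u. h (c + \<i> * of_real u)) has_real_derivative b) (at u)"
proof -
  have "((\<lambda>u. c + \<i> * complex_of_real u) has_derivative (\<lambda>t. \<i> * of_real t)) (at u)"
    by (auto intro!: derivative_eq_intros)
  from has_derivative_compose[OF this assms] show ?thesis
    by (simp add: has_field_derivative_def mult_commute_abs)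
qed

text \<open>The second difference D of h over a small square is evaluated by the mean value theorem
  in both orders, which gives s * s times \<open>hxy\<close> at one point and s * s times
  \<open>hyx\<close> at another; continuity does the rest. \<open>harmonic_on\<close> carries the
  two mixed partials as separate functions, and the Cauchy-Riemann equations need them
  equal.\<close>

lemma mixed_partials_eq:
  assumes "open S"
    and h: "\<And>z. z \<in> S \<Longrightarrow> (h has_derivative (\<lambda>w. hx z * Re w + hy z * Im w)) (at z)"
    and hx: "\<And>z. z \<in> S \<Longrightarrow> (hx has_derivative (\<lambda>w. hxx z * Re w + hxy z * Im w)) (at z)"
    and hy: "\<And>z. z \<in> S \<Longrightarrow> (hy has_derivative (\<lambda>w. hyx z * Re w + hyy z * Im w)) (at z)"
    and cont: "continuous_on S hxy" "continuous_on S hyx" and z: "z \<in> S"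
  shows "hxy z = hyx z"
proof -
  have "\<bar>hxy z - hyx z\<bar> \<le> e" if e: "e > 0" for e
  proof -
    obtain e0 where e0: "e0 > 0" "ball z e0 \<subseteq> S"
      using \<open>open S\<close> z openE by blast
    obtain e1 where e1: "e1 > 0" "\<And>y. y \<in> S \<Longrightarrow> dist y z < e1 \<Longrightarrow> dist (hxy y) (hxy z) < e / 2"
      using cont(1) z e half_gt_zero unfolding continuous_on_iff by metis
    obtain e2 where e2: "e2 > 0" "\<And>y. y \<in> S \<Longrightarrow> dist y z < e2 \<Longrightarrow> dist (hyx y) (hyx z) < e / 2"
      using cont(2) z e half_gt_zero unfolding continuous_on_iff by metis
    \<comment> \<open>Points of the square lie within 2 * s of z, and division by 3 keeps 2 * s
      below all three radii.\<close>
    define s where "s = min e0 (min e1 e2) / 3"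
    have s: "s > 0" "2 * s < e0" "2 * s < e1" "2 * s < e2" using e0 e1 e2 by (auto simp: s_def)
    define p where "p = (\<lambda>u v. z + of_real u + \<i> * of_real v)"
    have p: "p u v \<in> S" "dist (p u v) z \<le> 2 * s" if "0 \<le> u" "u \<le> s" "0 \<le> v" "v \<le> s" for u v
    proof -
      have "dist (p u v) z \<le> cmod (of_real u) + cmod (\<i> * of_real v)"
        unfolding p_def dist_norm using norm_triangle_ineq[of "of_real u" "\<i> * of_real v"] by simp
      also have "\<dots> \<le> 2 * s" using that by (simp add: norm_mult)
      finally show "dist (p u v) z \<le> 2 * s" .
      then show "p u v \<in> S" using s e0(2) by (auto simp: subset_iff dist_commute)
    qed
    have pu: "((\<lambda>u. f (p u v)) has_real_derivative a) (at u)"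
      if "(f has_derivative (\<lambda>w. a * Re w + b * Im w)) (at (p u v))" for f a b u v
      using has_real_derivative_horizontal[of f a b "z + \<i> * of_real v" u] that
      by (simp add: p_def add_ac)
    have pv: "((\<lambda>v. f (p u v)) has_real_derivative b) (at v)"
      if "(f has_derivative (\<lambda>w. a * Re w + b * Im w)) (at (p u v))" for f a b u v
      using has_real_derivative_vertical[of f a b "z + of_real u" v] that
      by (simp add: p_def)
    define D where "D = h (p s s) - h (p s 0) - (h (p 0 s) - h (p 0 0))"
    have "\<exists>x>0. x < s \<and> (h (p s s) - h (p s 0)) - (h (p 0 s) - h (p 0 0))
        = (s - 0) * (hx (p x s) - hx (p x 0))"
      by (rule MVT2[where f = "\<lambda>u. h (p u s) - h (p u 0)"])
         (use s p in \<open>auto intro!: DERIV_diff pu[OF h]\<close>)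
    then obtain x where x: "0 < x" "x < s" "D = s * (hx (p x s) - hx (p x 0))"
      by (auto simp: D_def)
    have "\<exists>y>0. y < s \<and> hx (p x s) - hx (p x 0) = (s - 0) * hxy (p x y)"
      by (rule MVT2[where f = "\<lambda>v. hx (p x v)"]) (use s p x in \<open>auto intro!: pv[OF hx]\<close>)
    then obtain y where y: "0 < y" "y < s" "D = s * (s * hxy (p x y))"
      using x by auto
    have "\<exists>v>0. v < s \<and> (h (p s s) - h (p 0 s)) - (h (p s 0) - h (p 0 0))
        = (s - 0) * (hy (p s v) - hy (p 0 v))"
      by (rule MVT2[where f = "\<lambda>v. h (p s v) - h (p 0 v)"])
         (use s p in \<open>auto intro!: DERIV_diff pv[OF h]\<close>)
    then obtain v where v: "0 < v" "v < s" "D = s * (hy (p s v) - hy (p 0 v))"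
      by (auto simp: D_def)
    have "\<exists>u>0. u < s \<and> hy (p s v) - hy (p 0 v) = (s - 0) * hyx (p u v)"
      by (rule MVT2[where f = "\<lambda>u. hy (p u v)"]) (use s p v in \<open>auto intro!: pu[OF hy]\<close>)
    then obtain u where u: "0 < u" "u < s" "D = s * (s * hyx (p u v))"
      using v by auto
    have eq: "hxy (p x y) = hyx (p u v)" using y u s by auto
    have "dist (hxy (p x y)) (hxy z) < e / 2"
      using p[of x y] x y s by (intro e1) auto
    moreover have "dist (hyx (p u v)) (hyx z) < e / 2"
      using p[of u v] u v s by (intro e2) auto
    ultimately show ?thesis using eq unfolding dist_real_def by linarith
  qed
  then have "\<bar>hxy z - hyx z\<bar> \<le> 0" by (rule field_le_epsilon[where y = 0, simplified])
  then show ?thesis by simp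
qed

text \<open>The function g = hx - i hy, twice the Wirtinger derivative of h, is holomorphic: its
  Cauchy-Riemann equations are the vanishing Laplacian and the symmetry of the mixed partials. On a
  convex set it has a primitive, whose real part has the gradient of h and so differs from h by a
  constant.\<close>

lemma harmonic_on_Re_holomorphic:
  assumes "harmonic_on h S" "convex S" "open S"
  obtains G where "G holomorphic_on S" "\<And>z. z \<in> S \<Longrightarrow> h z = Re (G z)"
proof -
  obtain hx hy hxx hxy hyx hyy where
    h: "\<And>z. z \<in> S \<Longrightarrow> (h has_derivative (\<lambda>w. hx z * Re w + hy z * Im w)) (at z)"
    and hx: "\<And>z. z \<in> S \<Longrightarrow> (hx has_derivative (\<lambda>w. hxx z * Re w + hxy z * Im w)) (at z)"
    and hy: "\<And>z. z \<in> S \<Longrightarrow> (hy has_derivative (\<lambda>w. hyx z * Re w + hyy z * Im w)) (at z)"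
    and lap: "\<And>z. z \<in> S \<Longrightarrow> hxx z + hyy z = 0"
    and cont: "continuous_on S hxy" "continuous_on S hyx"
    using assms(1) unfolding harmonic_on_def by blast
  define g where "g = (\<lambda>z. complex_of_real (hx z) - \<i> * of_real (hy z))"
  have g: "(g has_field_derivative of_real (hxx z) - \<i> * of_real (hyx z)) (at z)" if z: "z \<in> S" for z
  proof -
    have mixed: "hxy z = hyx z"
      by (rule mixed_partials_eq[OF \<open>open S\<close> h hx hy cont z])
    have "(g has_derivative (\<lambda>w. of_real (hxx z * Re w + hxy z * Im w)
        - \<i> * of_real (hyx z * Re w + hyy z * Im w))) (at z)"
      unfolding g_def using hx[OF z] hy[OF z] by (auto intro!: derivative_eq_intros)
    also have "(\<lambda>w. of_real (hxx z * Re w + hxy z * Im w) - \<i> * of_real (hyx z * Re w + hyy z * Im w))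
        = (*) (of_real (hxx z) - \<i> * of_real (hyx z))"
    proof -
      have "hyy z = - hxx z" using lap[OF z] by linarith
      then show ?thesis using mixed by (auto simp: fun_eq_iff complex_eq_iff algebra_simps)
    qed
    finally show ?thesis by (simp add: has_field_derivative_def)
  qed
  then have "g holomorphic_on S"
    using \<open>open S\<close> by (auto simp: holomorphic_on_open)
  then obtain G where G: "\<And>z. z \<in> S \<Longrightarrow> (G has_field_derivative g z) (at z within S)"
    using holomorphic_convex_primitive' assms by blast
  have G': "(G has_field_derivative g z) (at z)" if "z \<in> S" for z
    using G[OF that] at_within_open[OF that \<open>open S\<close>] by simp
  have "\<exists>c. \<forall>z\<in>S. h z - Re (G z) = c"
  proof (rule has_derivative_zero_constant[OF \<open>convex S\<close>])
    fix z assume z: "z \<in> S"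
    have "((\<lambda>z. Re (G z)) has_derivative (\<lambda>w. Re (g z * w))) (at z)"
      using G'[OF z] unfolding has_field_derivative_def by (rule has_derivative_Re)
    from has_derivative_diff[OF h[OF z] this]
    have "((\<lambda>z. h z - Re (G z)) has_derivative (\<lambda>w. 0)) (at z)"
      by (simp add: g_def algebra_simps)
    then show "((\<lambda>z. h z - Re (G z)) has_derivative (\<lambda>w. 0)) (at z within S)"
      by (rule has_derivative_at_withinI)
  qed
  then obtain c where c: "\<And>z. z \<in> S \<Longrightarrow> h z - Re (G z) = c" by blast
  show ?thesis
  proof
    show "(\<lambda>z. G z + of_real c) holomorphic_on S"
    proof -
      have "G holomorphic_on S" using G' by (auto simp: holomorphic_on_open[OF \<open>open S\<close>])
      then show ?thesis by (intro holomorphic_intros)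
    qed
    show "h z = Re (G z + of_real c)" if "z \<in> S" for z using c[OF that] by simp
  qed
qed

text \<open>To the Cauchy kernel is added cnj z / (1 - cnj z * u), whose only possible pole, the
  reflection of z in the circle, lies outside the closed disc. The addition does not change the
  integral, and it turns the kernel into a real one, so real parts can be taken.\<close>

lemma poisson_formula_holomorphic:
  assumes F: "F holomorphic_on cball 0 1" and z: "z \<in> unit_disc"
  shows "((\<lambda>t. Re (F (cis t)) * ((1 - (cmod z)\<^sup>2) / (cmod (cis t - z))\<^sup>2)) has_integral
    2 * pi * Re (F z)) {0..2 * pi}"
proof -
  let ?k = "\<lambda>u. F u / (u - z) + F u * (cnj z / (1 - cnj z * u))"
  have ne: "1 - cnj z * u \<noteq> 0" if "u \<in> cball 0 1" for u
  proof
    assume "1 - cnj z * u = 0"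
    then have "cmod z * cmod u = 1"
      by (metis eq_iff_diff_eq_0 complex_mod_cnj norm_mult norm_one)
    moreover have "cmod z * cmod u \<le> cmod z * 1" using that by (intro mult_left_mono) auto
    ultimately show False using z by auto
  qed
  have "((\<lambda>u. F u / (u - z)) has_contour_integral 2 * of_real pi * \<i> * F z) (circlepath 0 1)"
    using F z by (intro Cauchy_integral_circlepath_simple) auto
  moreover have "((\<lambda>u. F u * (cnj z / (1 - cnj z * u))) has_contour_integral 0) (circlepath 0 1)"
    using F ne by (intro Cauchy_theorem_convex_simple[where S = "cball 0 1"]) (auto intro!: holomorphic_intros)
  ultimately have "(?k has_contour_integral 2 * of_real pi * \<i> * F z) (circlepath 0 1)"
    using has_contour_integral_add by fastforce
  then have "((\<lambda>t. ?k (0 + of_real 1 * cis t) * of_real 1 * \<i> * cis t) has_integral 2 * of_real pi * \<i> * F z) {0..2 * pi}"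
    unfolding circlepath_def by (subst (asm) has_contour_integral_part_circlepath_iff) auto
  from has_integral_mult_right[OF this, of "- \<i>"]
  have "((\<lambda>t. - \<i> * (?k (cis t) * \<i> * cis t)) has_integral 2 * of_real pi * F z) {0..2 * pi}"
    by (simp add: mult.commute mult.left_commute)
  moreover have "- \<i> * (?k (cis t) * \<i> * cis t)
      = F (cis t) * of_real ((1 - (cmod z)\<^sup>2) / (cmod (cis t - z))\<^sup>2)" for t
  proof -
    define u where "u = cis t"
    have uu: "u * cnj u = 1" by (simp add: u_def cis_cnj cis_mult)
    have nz: "u - z \<noteq> 0" "cnj u - cnj z \<noteq> 0" "u \<noteq> 0"
      using z by (auto simp: u_def dest!: arg_cong[where f = cmod] simp flip: complex_cnj_diff)
    \<comment> \<open>Since u * cnj u = 1, the added term times u becomes cnj z / (cnj u - cnj z),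
      which together with u / (u - z) makes the Poisson kernel.\<close>
    have "1 - cnj z * u = u * (cnj u - cnj z)" by (simp add: algebra_simps uu)
    then have 1: "cnj z / (1 - cnj z * u) * u = cnj z / (cnj u - cnj z)"
      using nz by simp
    have "- \<i> * (x * \<i> * y) = x * y" for x y by (simp add: complex_eq_iff algebra_simps)
    then have "- \<i> * (?k u * \<i> * u) = ?k u * u" .
    also have "\<dots> = F u * (u / (u - z)) + F u * (cnj z / (1 - cnj z * u) * u)"
      by (simp add: distrib_right)
    also have "\<dots> = F u * (u / (u - z) + cnj z / (cnj u - cnj z))"
      unfolding 1 by (rule distrib_left[symmetric])
    also have "u / (u - z) + cnj z / (cnj u - cnj z) = (u * cnj u - z * cnj z) / ((u - z) * cnj (u - z))"
      using nz by (simp add: field_simps)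
    also have "\<dots> = of_real ((1 - (cmod z)\<^sup>2) / (cmod (u - z))\<^sup>2)"
      by (simp only: uu of_real_divide of_real_diff of_real_1 complex_norm_square)
    finally show ?thesis unfolding u_def .
  qed
  ultimately have "((\<lambda>t. F (cis t) * of_real ((1 - (cmod z)\<^sup>2) / (cmod (cis t - z))\<^sup>2)) has_integral
      2 * of_real pi * F z) {0..2 * pi}"
    by (simp only:)
  from has_integral_linear[OF this bounded_linear_Re] show ?thesis
    by (simp add: comp_def)
qed

lemma nn_integral_circle_measure_has_integral:
  assumes f: "f \<in> borel_measurable circle_measure" and nonneg: "\<And>\<xi>. \<xi> \<in> unit_circle \<Longrightarrow> 0 \<le> f \<xi>"
    and I: "((\<lambda>t. f (cis t)) has_integral 2 * pi * I) {0..2 * pi}"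
  shows "(\<integral>\<^sup>+\<xi>. ennreal (f \<xi>) \<partial>circle_measure) = ennreal I"
proof -
  have I0: "0 \<le> I"
  proof -
    have "0 \<le> 2 * pi * I" by (rule has_integral_nonneg[OF I]) (use nonneg in auto)
    then show ?thesis using pi_gt_zero by (auto simp: zero_le_mult_iff)
  qed
  have "(\<integral>\<^sup>+\<xi>. ennreal (f \<xi>) \<partial>circle_measure)
      = (\<integral>\<^sup>+t. ennreal (f (cis t)) * indicator {0..<2 * pi} t \<partial>lborel) / ennreal (2 * pi)"
    using f by (intro nn_integral_circle_measure) simp
  \<comment> \<open>The half-open window of \<open>circle_measure\<close> and the closed interval of
    the gauge integral differ by the null point 2 * pi.\<close>
  also have "(\<integral>\<^sup>+t. ennreal (f (cis t)) * indicator {0..<2 * pi} t \<partial>lborel)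
      = (\<integral>\<^sup>+t. ennreal (f (cis t)) * indicator {0..2 * pi} t \<partial>lborel)"
    using AE_lborel_singleton[of "2 * pi"]
    by (intro nn_integral_cong_AE) (auto split: split_indicator elim!: eventually_mono)
  also have "\<dots> = ennreal (2 * pi * I)"
    by (rule nn_integral_has_integral_lebesgue'[OF _ I]) (use nonneg in auto)
  also have "ennreal (2 * pi * I) / ennreal (2 * pi) = ennreal I"
    using I0 by (simp add: divide_ennreal)
  finally show ?thesis .
qed

lemma borel_measurable_circle_continuous:
  assumes "continuous_on unit_circle f"
  shows "f \<in> borel_measurable circle_measure"
  using borel_measurable_continuous_on_restrict[OF assms]
  by (simp cong: measurable_cong_sets add: sets_circle_measure)

text \<open>For r < 1 the function G (r w) is holomorphic in w on the closed disc, so the Poisson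
  formula applies up to the boundary. The nonnegative integral suits the later reading of h (r
  \<xi>) as the density of a measure.\<close>

lemma positive_harmonic_poisson_dilation:
  assumes h: "positive_harmonic h" and z: "z \<in> unit_disc" and r: "0 < r" "r < 1"
  shows "(\<lambda>\<xi>. h (of_real r * \<xi>)) \<in> borel_measurable circle_measure"
    and "(\<integral>\<^sup>+\<xi>. ennreal ((1 - (cmod z)\<^sup>2) / (cmod (\<xi> - z))\<^sup>2) * ennreal (h (of_real r * \<xi>)) \<partial>circle_measure)
      = ennreal (h (of_real r * z))"
proof -
  obtain G where G: "G holomorphic_on unit_disc" "\<And>w. w \<in> unit_disc \<Longrightarrow> h w = Re (G w)"
    using harmonic_on_Re_holomorphic[of h unit_disc] h by (auto simp: positive_harmonic_def)
  have in_disc: "of_real r * w \<in> unit_disc" if "w \<in> cball 0 1" for w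
  proof -
    have "r * cmod w \<le> r * 1" using that r by (intro mult_left_mono) auto
    then have "r * cmod w < 1" using r by linarith
    then show ?thesis using r by (simp add: norm_mult)
  qed
  define F where "F = (\<lambda>w. G (of_real r * w))"
  have F: "F holomorphic_on cball 0 1"
    unfolding F_def using in_disc
    by (intro holomorphic_on_compose_gen[OF _ G(1), unfolded comp_def] holomorphic_intros) auto
  have hF: "h (of_real r * w) = Re (F w)" if "w \<in> cball 0 1" for w
    using G(2)[OF in_disc[OF that]] by (simp add: F_def)
  have "continuous_on (cball 0 1) F" using F by (rule holomorphic_on_imp_continuous_on)
  then have "continuous_on unit_circle (\<lambda>w. Re (F w))"
    by (intro continuous_intros) (auto elim: continuous_on_subset)
  then have "continuous_on unit_circle (\<lambda>w. h (of_real r * w))"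
    by (rule continuous_on_eq) (auto simp: hF)
  then show meas: "(\<lambda>\<xi>. h (of_real r * \<xi>)) \<in> borel_measurable circle_measure"
    by (rule borel_measurable_circle_continuous)
  have nonneg: "0 \<le> h (of_real r * \<xi>)" if "\<xi> \<in> unit_circle" for \<xi>
    using h in_disc[of \<xi>] that by (auto simp: positive_harmonic_def)
  have P: "0 \<le> (1 - (cmod z)\<^sup>2) / (cmod (\<xi> - z))\<^sup>2" for \<xi>
    using z by (simp add: abs_square_le_1)
  have "(\<integral>\<^sup>+\<xi>. ennreal ((1 - (cmod z)\<^sup>2) / (cmod (\<xi> - z))\<^sup>2) * ennreal (h (of_real r * \<xi>)) \<partial>circle_measure)
      = (\<integral>\<^sup>+\<xi>. ennreal (h (of_real r * \<xi>) * ((1 - (cmod z)\<^sup>2) / (cmod (\<xi> - z))\<^sup>2)) \<partial>circle_measure)"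
  proof (rule nn_integral_cong)
    fix \<xi> assume "\<xi> \<in> space circle_measure"
    then show "ennreal ((1 - (cmod z)\<^sup>2) / (cmod (\<xi> - z))\<^sup>2) * ennreal (h (of_real r * \<xi>))
        = ennreal (h (of_real r * \<xi>) * ((1 - (cmod z)\<^sup>2) / (cmod (\<xi> - z))\<^sup>2))"
      using ennreal_mult[OF nonneg P, of \<xi> \<xi>] by (simp only: mult.commute space_circle_measure)
  qed
  also have "\<dots> = ennreal (h (of_real r * z))"
  proof (rule nn_integral_circle_measure_has_integral)
    show "(\<lambda>\<xi>. h (of_real r * \<xi>) * ((1 - (cmod z)\<^sup>2) / (cmod (\<xi> - z))\<^sup>2)) \<in> borel_measurable circle_measure"
      by (intro borel_measurable_times meas borel_measurable_poisson_kernel)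
    show "0 \<le> h (of_real r * \<xi>) * ((1 - (cmod z)\<^sup>2) / (cmod (\<xi> - z))\<^sup>2)" if "\<xi> \<in> unit_circle" for \<xi>
      using nonneg[OF that] P[of \<xi>] by (rule mult_nonneg_nonneg)
    show "((\<lambda>t. h (of_real r * cis t) * ((1 - (cmod z)\<^sup>2) / (cmod (cis t - z))\<^sup>2)) has_integral
        2 * pi * h (of_real r * z)) {0..2 * pi}"
      using poisson_formula_holomorphic[OF F z] z by (simp add: hF)
  qed
  finally show "(\<integral>\<^sup>+\<xi>. ennreal ((1 - (cmod z)\<^sup>2) / (cmod (\<xi> - z))\<^sup>2) * ennreal (h (of_real r * \<xi>)) \<partial>circle_measure)
      = ennreal (h (of_real r * z))" .
qed

section \<open>The two tail estimates\<close>

text \<open>If no ball about \<zeta> were dense, the growth bound would hold at every radius, and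
  each product in the supremum would be at most 66 * \<alpha> * 32 * A = t. Only domination by the
  Poisson integral is asked, so that u may be a dilation of h in (a) and \<phi> itself in
  (b).\<close>

lemma shadow_maximal_greater_dense:
  assumes \<alpha>: "\<alpha> \<ge> 1" and M: "sets M = sets circle_measure"
    and u: "\<And>z. z \<in> unit_disc \<Longrightarrow>
      ennreal (u z) \<le> (\<integral>\<^sup>+\<xi>. ennreal ((1 - (cmod z)\<^sup>2) / (cmod (\<xi> - z))\<^sup>2) \<partial>M)"
    and t: "t > 0" and \<zeta>: "\<zeta> \<in> unit_circle" and less: "ennreal t < shadow_maximal \<alpha> u \<zeta>"
  shows "\<exists>r>0. ennreal (t / (2112 * \<alpha>) * r) < emeasure M (unit_circle \<inter> cball \<zeta> r)"
proof (rule ccontr)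
  define A where "A = t / (2112 * \<alpha>)"
  have A: "A \<ge> 0" using \<alpha> t by (simp add: A_def)
  assume "\<not> (\<exists>r>0. ennreal (t / (2112 * \<alpha>) * r) < emeasure M (unit_circle \<inter> cball \<zeta> r))"
  then have growth: "emeasure M (unit_circle \<inter> cball \<zeta> r) \<le> ennreal (A * r)" if "r > 0" for r
    using that unfolding A_def by (metis not_le)
  obtain z where z: "z \<in> unit_disc"
      "ennreal t < ennreal (u z) * hl_maximal (indicator (privalov_shadow \<alpha> z)) \<zeta>"
    using less by (auto simp: shadow_maximal_def less_SUP_iff)
  define k where "k = (1 - cmod z) / cmod (\<zeta> - z)"
  have k: "k \<ge> 0" using z by (simp add: k_def)
  let ?P = "\<integral>\<^sup>+\<xi>. ennreal ((1 - (cmod z)\<^sup>2) / (cmod (\<xi> - z))\<^sup>2) \<partial>M"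
  note z(2)
  also have "ennreal (u z) * hl_maximal (indicator (privalov_shadow \<alpha> z)) \<zeta>
      \<le> ?P * ennreal (66 * \<alpha> * k)"
    unfolding k_def by (intro mult_mono u z hl_maximal_shadow_le \<alpha> \<zeta>) auto
  also have "\<dots> = ennreal (66 * \<alpha>) * (?P * ennreal k)"
    using \<alpha> k by (simp add: ennreal_mult mult_ac)
  also have "\<dots> \<le> ennreal (66 * \<alpha>) * ennreal (32 * A)"
    unfolding k_def using growth
    by (intro mult_left_mono poisson_nn_integral_bound[OF M A _ z(1) \<zeta>]) auto
  also have "\<dots> = ennreal (66 * \<alpha> * (32 * A))"
    using \<alpha> A by (intro ennreal_mult[symmetric]) auto
  also have "66 * \<alpha> * (32 * A) = t"
    using \<alpha> by (simp add: A_def)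
  finally show False by simp
qed

lemma emeasure_shadow_maximal_greater_le:
  assumes \<alpha>: "\<alpha> \<ge> 1" and h: "positive_harmonic h"
    and \<phi>: "\<And>z. z \<in> unit_disc \<Longrightarrow> \<phi> z \<le> h z" and t: "t > 0"
  shows "emeasure circle_measure {\<zeta> \<in> unit_circle. ennreal t < shadow_maximal \<alpha> \<phi> \<zeta>}
    \<le> ennreal (21120 * \<alpha> / t * h 0)"
proof -
  define r where "r = (\<lambda>n::nat. 1 - 1 / (real n + 2))"
  have r: "0 < r n" "r n < 1" for n by (auto simp: r_def field_simps)
  have r_lim: "r \<longlonglongrightarrow> 1"
    unfolding r_def by real_asymp
  define E where "E = (\<lambda>n. {\<zeta> \<in> unit_circle. ennreal t < shadow_maximal \<alpha> (\<lambda>z. h (of_real (r n) * z)) \<zeta>})"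
  have E_sets: "E n \<in> sets circle_measure" for n
    unfolding E_def by (rule shadow_maximal_greater_sets)
  have h0: "0 \<le> h 0" using h by (simp add: positive_harmonic_def)
  have E_le: "emeasure circle_measure (E n) \<le> ennreal (21120 * \<alpha> / t * h 0)" for n
  proof -
    let ?f = "\<lambda>\<xi>. ennreal (h (of_real (r n) * \<xi>))"
    define M where "M = density circle_measure ?f"
    have f: "?f \<in> borel_measurable circle_measure"
      using positive_harmonic_poisson_dilation(1)[OF h _ r[of n], of 0] by simp
    have M: "sets M = sets circle_measure" by (simp add: M_def)
    have P: "(\<integral>\<^sup>+\<xi>. ennreal ((1 - (cmod z)\<^sup>2) / (cmod (\<xi> - z))\<^sup>2) \<partial>M) = ennreal (h (of_real (r n) * z))"
      if "z \<in> unit_disc" for z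
    proof -
      have "(\<integral>\<^sup>+\<xi>. ennreal ((1 - (cmod z)\<^sup>2) / (cmod (\<xi> - z))\<^sup>2) \<partial>M)
          = (\<integral>\<^sup>+\<xi>. ?f \<xi> * ennreal ((1 - (cmod z)\<^sup>2) / (cmod (\<xi> - z))\<^sup>2) \<partial>circle_measure)"
        unfolding M_def using f borel_measurable_poisson_kernel by (intro nn_integral_density) auto
      also have "\<dots> = ennreal (h (of_real (r n) * z))"
        using positive_harmonic_poisson_dilation(2)[OF h that r[of n]] by (simp add: mult.commute)
      finally show ?thesis .
    qed
    have sp: "space M = unit_circle" by (simp add: M_def space_circle_measure)
    \<comment> \<open>At z = 0 the Poisson kernel is 1 on the circle, so every dilation has the same
      total mass.\<close>
    have total: "emeasure M unit_circle = ennreal (h 0)"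
    proof -
      have "emeasure M unit_circle = (\<integral>\<^sup>+\<xi>. 1 \<partial>M)"
        by (simp add: sp)
      also have "\<dots> = (\<integral>\<^sup>+\<xi>. ennreal ((1 - (cmod 0)\<^sup>2) / (cmod (\<xi> - 0))\<^sup>2) \<partial>M)"
        by (intro nn_integral_cong) (simp add: sp)
      also have "\<dots> = ennreal (h 0)" using P[of 0] by simp
      finally show ?thesis .
    qed
    have fin: "finite_measure M"
      by (rule finite_measureI) (simp add: sp total)
    have "emeasure circle_measure (E n) \<le> ennreal (10 / (t / (2112 * \<alpha>))) * emeasure M unit_circle"
    proof (rule emeasure_dense_points_le[OF M fin])
      show "0 < t / (2112 * \<alpha>)" using \<alpha> t by simp
      show "E n \<subseteq> unit_circle" by (auto simp: E_def)
      fix \<zeta> assume "\<zeta> \<in> E n"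
      then show "\<exists>r>0. ennreal (t / (2112 * \<alpha>) * r) < emeasure M (unit_circle \<inter> cball \<zeta> r)"
        unfolding E_def by (intro shadow_maximal_greater_dense[OF \<alpha> M _ t]) (auto simp: P)
    qed
    also have "\<dots> = ennreal (10 / (t / (2112 * \<alpha>)) * h 0)"
      unfolding total using \<alpha> t h0 by (intro ennreal_mult[symmetric]) auto
    finally show ?thesis using \<alpha> t by (simp add: field_simps)
  qed
  \<comment> \<open>The sets \<open>E n\<close> need not be nested. Their tail intersections
    increase and each lies in some \<open>E N\<close>, so continuity from below preserves the bound
    for the union.\<close>
  let ?F = "\<lambda>N. \<Inter>m\<in>{N..}. E m"
  have F_sets: "?F N \<in> sets circle_measure" for N
    by (rule sets.countable_INT) (auto simp: E_sets)
  have "{\<zeta> \<in> unit_circle. ennreal t < shadow_maximal \<alpha> \<phi> \<zeta>} \<subseteq> (\<Union>N. ?F N)"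
  proof safe
    fix \<zeta> assume \<zeta>: "\<zeta> \<in> unit_circle" and "ennreal t < shadow_maximal \<alpha> \<phi> \<zeta>"
    then obtain z where z: "z \<in> unit_disc"
        "ennreal t < ennreal (\<phi> z) * hl_maximal (indicator (privalov_shadow \<alpha> z)) \<zeta>"
      by (auto simp: shadow_maximal_def less_SUP_iff)
    define H where "H = hl_maximal (indicator (privalov_shadow \<alpha> z)) \<zeta>"
    \<comment> \<open>Multiplication by a finite H is continuous on \<open>ennreal\<close>, so the
      strict inequality at the single witness z passes from h z to h (r n * z) for all large
      n.\<close>
    have H: "H < top"
      unfolding H_def using hl_maximal_shadow_le[OF \<alpha> z(1) \<zeta>] by (rule le_less_trans) simp
    have "ennreal t < ennreal (\<phi> z) * H" using z by (simp add: H_def)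
    also have "\<dots> \<le> ennreal (h z) * H" using z \<phi> by (intro mult_right_mono ennreal_leI) auto
    finally have less: "ennreal t < H * ennreal (h z)" by (simp add: mult.commute)
    have "isCont h z"
      using h z(1) unfolding positive_harmonic_def harmonic_on_def
      by (meson has_derivative_continuous)
    moreover have "(\<lambda>n. of_real (r n) * z) \<longlonglongrightarrow> of_real 1 * z"
      by (intro tendsto_intros r_lim)
    ultimately have "(\<lambda>n. h (of_real (r n) * z)) \<longlonglongrightarrow> h z"
      by (auto intro: isCont_tendsto_compose)
    then have "(\<lambda>n. H * ennreal (h (of_real (r n) * z))) \<longlonglongrightarrow> H * ennreal (h z)"
      by (intro ennreal_tendsto_cmult[OF H] tendsto_ennrealI)
    from order_tendstoD(1)[OF this less]
    obtain N where N: "\<And>n. n \<ge> N \<Longrightarrow> ennreal t < H * ennreal (h (of_real (r n) * z))"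
      by (auto simp: eventually_sequentially)
    have "\<zeta> \<in> E n" if "n \<ge> N" for n
      unfolding E_def shadow_maximal_def less_SUP_iff
      using N[OF that] by (intro CollectI conjI \<zeta> bexI[OF _ z(1)]) (simp add: H_def mult.commute)
    then have "\<zeta> \<in> ?F N" by auto
    then show "\<zeta> \<in> (\<Union>N. ?F N)" by blast
  qed
  then have "emeasure circle_measure {\<zeta> \<in> unit_circle. ennreal t < shadow_maximal \<alpha> \<phi> \<zeta>}
      \<le> emeasure circle_measure (\<Union>N. ?F N)"
    using F_sets by (intro emeasure_mono) auto
  also have "\<dots> = (SUP N. emeasure circle_measure (?F N))"
    using F_sets by (intro SUP_emeasure_incseq[symmetric]) (auto simp: incseq_def)
  also have "\<dots> \<le> ennreal (21120 * \<alpha> / t * h 0)"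
  proof (rule SUP_least)
    fix N
    have "emeasure circle_measure (?F N) \<le> emeasure circle_measure (E N)"
      by (intro emeasure_mono E_sets) auto
    also note E_le
    finally show "emeasure circle_measure (?F N) \<le> ennreal (21120 * \<alpha> / t * h 0)" .
  qed
  finally show ?thesis .
qed

lemma shadow_maximal_weak_L1:
  assumes \<alpha>: "\<alpha> \<ge> 1" and h: "positive_harmonic_majorant h \<phi>"
  shows "(\<lambda>\<zeta>. enn2ereal (shadow_maximal \<alpha> \<phi> \<zeta>)) \<in> weak_L1"
proof -
  have h': "positive_harmonic h" "\<And>z. z \<in> unit_disc \<Longrightarrow> \<phi> z \<le> h z"
    using h by (auto simp: positive_harmonic_majorant_def)
  have h0: "0 \<le> h 0" using h'(1) by (simp add: positive_harmonic_def)
  have "(SUP t\<in>{0<..}. ennreal t * circle_tail (\<lambda>\<zeta>. enn2ereal (shadow_maximal \<alpha> \<phi> \<zeta>)) t)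
      \<le> ennreal (21120 * \<alpha> * h 0)"
  proof (rule SUP_least)
    fix t :: real assume "t \<in> {0<..}"
    then have t: "t > 0" by simp
    have "ennreal t * circle_tail (\<lambda>\<zeta>. enn2ereal (shadow_maximal \<alpha> \<phi> \<zeta>)) t
        \<le> ennreal t * ennreal (21120 * \<alpha> / t * h 0)"
      using t emeasure_shadow_maximal_greater_le[OF \<alpha> h'(1), of \<phi> t] h'(2)
      by (auto simp: circle_tail_shadow_maximal intro!: mult_left_mono)
    also have "\<dots> = ennreal (t * (21120 * \<alpha> / t * h 0))"
      using t \<alpha> h0 by (intro ennreal_mult[symmetric]) auto
    also have "t * (21120 * \<alpha> / t * h 0) = 21120 * \<alpha> * h 0" using t by simp
    finally show "ennreal t * circle_tail (\<lambda>\<zeta>. enn2ereal (shadow_maximal \<alpha> \<phi> \<zeta>)) t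
        \<le> ennreal (21120 * \<alpha> * h 0)" .
  qed
  also have "\<dots> < \<infinity>" by simp
  finally show ?thesis
    by (simp add: weak_L1_def borel_measurable_completion_shadow_maximal)
qed

lemma shadow_maximal_weak_L1_0:
  assumes \<alpha>: "\<alpha> \<ge> 1" and h: "positive_harmonic_majorant h \<phi>" and qb: "quasi_bounded h"
  shows "(\<lambda>\<zeta>. enn2ereal (shadow_maximal \<alpha> \<phi> \<zeta>)) \<in> weak_L1_0"
proof -
  interpret \<sigma>: finite_measure circle_measure by (rule finite_measure_circle_measure)
  obtain \<mu> where \<mu>: "finite_measure \<mu>" "sets \<mu> = sets circle_measure"
      "absolutely_continuous circle_measure \<mu>" "\<And>z. z \<in> unit_disc \<Longrightarrow> h z = poisson_integral \<mu> z"
    using qb by (auto simp: quasi_bounded_def)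
  obtain f where f [measurable]: "f \<in> borel_measurable circle_measure" and \<mu>f: "density circle_measure f = \<mu>"
    using \<sigma>.Radon_Nikodym[OF \<mu>(3,2)] by auto
  \<comment> \<open>The full value of f is kept where f > N, which avoids subtraction in
    \<open>ennreal\<close>: f \<le> N + g N pointwise, and f dominates every g N.\<close>
  define g where "g = (\<lambda>(N::nat) \<xi>. f \<xi> * indicator {\<xi> \<in> space circle_measure. of_nat N < f \<xi>} \<xi>)"
  have g [measurable]: "g N \<in> borel_measurable circle_measure" for N
    unfolding g_def by measurable
  define \<nu> where "\<nu> = (\<lambda>N. density circle_measure (g N))"
  have \<nu>_sets: "sets (\<nu> N) = sets circle_measure" for N by (simp add: \<nu>_def)
  have \<nu>_total: "emeasure (\<nu> N) unit_circle = (\<integral>\<^sup>+\<xi>. g N \<xi> \<partial>circle_measure)" for N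
    unfolding \<nu>_def by (subst emeasure_density) (auto simp: borel_circle_iff space_circle_measure intro!: nn_integral_cong)
  have g_le: "g N \<xi> \<le> f \<xi>" for N \<xi> by (simp add: g_def split: split_indicator)
  have f_fin: "(\<integral>\<^sup>+\<xi>. f \<xi> \<partial>circle_measure) < \<infinity>"
  proof -
    have "(\<integral>\<^sup>+\<xi>. f \<xi> \<partial>circle_measure) = emeasure \<mu> (space \<mu>)"
      unfolding \<mu>f[symmetric] by (subst emeasure_density) (auto intro!: nn_integral_cong)
    also have "\<dots> < \<infinity>"
      using finite_measure.emeasure_finite[OF \<mu>(1)] by (simp add: less_top)
    finally show ?thesis .
  qed
  have \<nu>_fin: "finite_measure (\<nu> N)" for N
  proof (rule finite_measureI)
    have "(\<integral>\<^sup>+\<xi>. g N \<xi> \<partial>circle_measure) \<le> (\<integral>\<^sup>+\<xi>. f \<xi> \<partial>circle_measure)"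
      by (intro nn_integral_mono g_le)
    also note f_fin
    finally have "emeasure (\<nu> N) unit_circle < \<infinity>" unfolding \<nu>_total .
    moreover have "space (\<nu> N) = unit_circle" by (simp add: \<nu>_def space_circle_measure)
    ultimately show "emeasure (\<nu> N) (space (\<nu> N)) \<noteq> \<infinity>" by simp
  qed
  have \<nu>_lim: "(\<lambda>N. emeasure (\<nu> N) unit_circle) \<longlonglongrightarrow> 0"
  proof -
    have "(\<lambda>N. \<integral>\<^sup>+\<xi>. g N \<xi> \<partial>circle_measure) \<longlonglongrightarrow> (\<integral>\<^sup>+\<xi>. 0 \<partial>circle_measure)"
    proof (rule nn_integral_dominated_convergence[where w = f])
      show "AE \<xi> in circle_measure. g N \<xi> \<le> f \<xi>" for N by (simp add: g_le)
      \<comment> \<open>Where f is infinite, g N stays infinite for all N; the finite integral makes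
        this a null set.\<close>
      have "AE \<xi> in circle_measure. f \<xi> \<noteq> \<infinity>"
        using f_fin by (intro nn_integral_PInf_AE) auto
      then show "AE \<xi> in circle_measure. (\<lambda>N. g N \<xi>) \<longlonglongrightarrow> 0"
      proof (rule AE_mp, intro AE_I2 impI)
        fix \<xi> assume "f \<xi> \<noteq> \<infinity>"
        then obtain N where N: "f \<xi> < of_nat N"
          using ennreal_Ex_less_of_nat[of "f \<xi>"] by (auto simp: less_top)
        have "g n \<xi> = 0" if "n \<ge> N" for n
        proof -
          have "f \<xi> < of_nat n" using N that by (meson less_le_trans of_nat_mono)
          then show ?thesis by (auto simp: g_def split: split_indicator)
        qed
        then show "(\<lambda>N. g N \<xi>) \<longlonglongrightarrow> 0"
          by (intro tendsto_eventually) (auto simp: eventually_sequentially)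
      qed
    qed (use f_fin in auto)
    then show ?thesis by (simp add: \<nu>_total)
  qed
  have \<mu>_le: "emeasure \<mu> B \<le> of_nat N * emeasure circle_measure B + emeasure (\<nu> N) B"
    if B [measurable]: "B \<in> sets circle_measure" for B N
  proof -
    have "emeasure \<mu> B = (\<integral>\<^sup>+\<xi>. f \<xi> * indicator B \<xi> \<partial>circle_measure)"
      unfolding \<mu>f[symmetric] by (rule emeasure_density) auto
    also have "\<dots> \<le> (\<integral>\<^sup>+\<xi>. of_nat N * indicator B \<xi> + g N \<xi> * indicator B \<xi> \<partial>circle_measure)"
      by (intro nn_integral_mono) (auto simp: g_def not_less split: split_indicator)
    also have "\<dots> = of_nat N * emeasure circle_measure B + emeasure (\<nu> N) B"
      unfolding \<nu>_def by (subst nn_integral_add) (auto simp: nn_integral_cmult_indicator emeasure_density)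
    finally show ?thesis .
  qed
  have dom: "ennreal (\<phi> z) \<le> (\<integral>\<^sup>+\<xi>. ennreal ((1 - (cmod z)\<^sup>2) / (cmod (\<xi> - z))\<^sup>2) \<partial>\<mu>)"
    if z: "z \<in> unit_disc" for z
  proof -
    have P: "0 \<le> (1 - (cmod z)\<^sup>2) / (cmod (\<xi> - z))\<^sup>2" for \<xi>
      using z by (simp add: abs_square_le_1)
    have m: "(\<lambda>\<xi>. (1 - (cmod z)\<^sup>2) / (cmod (\<xi> - z))\<^sup>2) \<in> borel_measurable \<mu>"
      using borel_measurable_poisson_kernel by (simp cong: measurable_cong_sets add: \<mu>(2))
    have "\<phi> z \<le> poisson_integral \<mu> z"
      using h z unfolding \<mu>(4)[OF z, symmetric] positive_harmonic_majorant_def by blast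
    also have "\<dots> = enn2real (\<integral>\<^sup>+\<xi>. ennreal ((1 - (cmod z)\<^sup>2) / (cmod (\<xi> - z))\<^sup>2) \<partial>\<mu>)"
      unfolding poisson_integral_def using m P by (intro integral_eq_nn_integral) auto
    finally have "ennreal (\<phi> z) \<le> ennreal (enn2real (\<integral>\<^sup>+\<xi>. ennreal ((1 - (cmod z)\<^sup>2) / (cmod (\<xi> - z))\<^sup>2) \<partial>\<mu>))"
      by (rule ennreal_leI)
    \<comment> \<open>\<open>enn2real\<close> sends infinity to 0, so this direction holds without a
      finiteness check.\<close>
    also have "\<dots> \<le> (\<integral>\<^sup>+\<xi>. ennreal ((1 - (cmod z)\<^sup>2) / (cmod (\<xi> - z))\<^sup>2) \<partial>\<mu>)"
      by (simp add: ennreal_enn2real_if)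
    finally show ?thesis .
  qed
  let ?E = "\<lambda>t. {\<zeta> \<in> unit_circle. ennreal t < shadow_maximal \<alpha> \<phi> \<zeta>}"
  have bound: "ennreal t * circle_tail (\<lambda>\<zeta>. enn2ereal (shadow_maximal \<alpha> \<phi> \<zeta>)) t
      \<le> ennreal (42240 * \<alpha>) * emeasure (\<nu> N) unit_circle"
    if t: "t > 0" "8448 * \<alpha> * real N \<le> t" for t N
  proof -
    define A where "A = t / (2112 * \<alpha>)"
    \<comment> \<open>The threshold 8448 = 4 * 2112 is what makes 2 * N at most A / 2, that is, the
      bounded part at most half of the density.\<close>
    have A: "A > 0" "2 * real N \<le> A / 2" using \<alpha> t by (auto simp: A_def field_simps)
    have "emeasure circle_measure (?E t) \<le> ennreal (10 / (A / 2)) * emeasure (\<nu> N) unit_circle"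
    proof (rule emeasure_dense_points_le[OF \<nu>_sets \<nu>_fin])
      show "0 < A / 2" using A by simp
      fix \<zeta> assume "\<zeta> \<in> ?E t"
      then have \<zeta>: "\<zeta> \<in> unit_circle" "ennreal t < shadow_maximal \<alpha> \<phi> \<zeta>" by auto
      obtain r where r: "r > 0" "ennreal (A * r) < emeasure \<mu> (unit_circle \<inter> cball \<zeta> r)"
        using shadow_maximal_greater_dense[OF \<alpha> \<mu>(2) dom t(1) \<zeta>] unfolding A_def by blast
      let ?B = "unit_circle \<inter> cball \<zeta> r"
      \<comment> \<open>The part of f below N contributes at most 2 * N * r, no more than half of A
        * r, so more than the other half must come from \<nu> N.\<close>
      have "\<not> emeasure (\<nu> N) ?B \<le> ennreal (A / 2 * r)"
      proof
        assume le: "emeasure (\<nu> N) ?B \<le> ennreal (A / 2 * r)"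
        note r(2)
        also have "emeasure \<mu> ?B \<le> of_nat N * emeasure circle_measure ?B + emeasure (\<nu> N) ?B"
          by (intro \<mu>_le) (auto simp: borel_circle_iff)
        also have "\<dots> \<le> ennreal (real N) * ennreal (2 * r) + ennreal (A / 2 * r)"
          using emeasure_circle_cball_le[OF \<zeta>(1), of r] r(1) le
          by (intro add_mono mult_mono) (auto simp: ennreal_of_nat_eq_real_of_nat)
        also have "\<dots> = ennreal (2 * real N * r + A / 2 * r)"
          using r(1) A(1) by (subst ennreal_plus) (auto simp: ennreal_mult[symmetric] mult_ac)
        also have "\<dots> \<le> ennreal (A * r)"
          using mult_right_mono[OF A(2), of r] r(1) by (intro ennreal_leI) (simp add: field_simps)
        finally show False by simp
      qed
      then show "\<exists>r>0. ennreal (A / 2 * r) < emeasure (\<nu> N) (unit_circle \<inter> cball \<zeta> r)"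
        using r(1) by (auto simp: not_le)
    qed auto
    then have "ennreal t * emeasure circle_measure (?E t)
        \<le> ennreal t * (ennreal (10 / (A / 2)) * emeasure (\<nu> N) unit_circle)"
      by (intro mult_left_mono) auto
    also have "\<dots> = ennreal (t * (10 / (A / 2))) * emeasure (\<nu> N) unit_circle"
      using t A by (subst ennreal_mult) (auto simp: mult.assoc)
    also have "t * (10 / (A / 2)) = 42240 * \<alpha>" using t(1) \<alpha> by (simp add: A_def)
    finally show ?thesis using t(1) by (simp add: circle_tail_shadow_maximal)
  qed
  have "((\<lambda>t. ennreal t * circle_tail (\<lambda>\<zeta>. enn2ereal (shadow_maximal \<alpha> \<phi> \<zeta>)) t) \<longlongrightarrow> 0) at_top"
  proof (rule order_tendstoI)
    fix a :: ennreal assume "0 < a"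
    have "(\<lambda>N. ennreal (42240 * \<alpha>) * emeasure (\<nu> N) unit_circle) \<longlonglongrightarrow> ennreal (42240 * \<alpha>) * 0"
      by (intro ennreal_tendsto_cmult \<nu>_lim) simp
    then have "eventually (\<lambda>N. ennreal (42240 * \<alpha>) * emeasure (\<nu> N) unit_circle < a) sequentially"
      using \<open>0 < a\<close> by (intro order_tendstoD(2)) auto
    \<comment> \<open>N is fixed first to make the tail mass small; only then does t grow past the
      threshold, which depends on N.\<close>
    then obtain N where N: "ennreal (42240 * \<alpha>) * emeasure (\<nu> N) unit_circle < a"
      by (auto simp: eventually_sequentially)
    show "eventually (\<lambda>t. ennreal t * circle_tail (\<lambda>\<zeta>. enn2ereal (shadow_maximal \<alpha> \<phi> \<zeta>)) t < a) at_top"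
      using eventually_gt_at_top[of "0::real"] eventually_ge_at_top[of "8448 * \<alpha> * real N"]
      by eventually_elim (use N bound le_less_trans in blast)
  qed simp
  then show ?thesis
    by (simp add: weak_L1_0_def borel_measurable_completion_shadow_maximal)
qed

theorem proposition1p7:
  fixes \<alpha> :: real and \<phi> :: "complex \<Rightarrow> real"
  assumes "\<alpha> \<ge> 1"
    and "\<phi> \<in> borel_measurable (restrict_space borel unit_disc)"
    and "\<And>z. z \<in> unit_disc \<Longrightarrow> 0 \<le> \<phi> z"
  shows "((\<exists>h. positive_harmonic_majorant h \<phi>) \<longrightarrow>
            (\<lambda>\<zeta>. enn2ereal (shadow_maximal \<alpha> \<phi> \<zeta>)) \<in> weak_L1) \<and>
         ((\<exists>h. positive_harmonic_majorant h \<phi> \<and> quasi_bounded h) \<longrightarrow>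
            (\<lambda>\<zeta>. enn2ereal (shadow_maximal \<alpha> \<phi> \<zeta>)) \<in> weak_L1_0)"
  using shadow_maximal_weak_L1[OF assms(1)] shadow_maximal_weak_L1_0[OF assms(1)] by blast

end
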